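(* Let $f\colon\mathbb T\to\mathbb R$ and $h\colon\mathbb T^2\to\mathbb R$ be Lipschitz, let $p$ be a probability density on $[0,1]$, extended $1$-periodically to $\mathbb R$, and let $c>0$ be such that $p(x)>c$ for all $x\in[0,1]$. Assume $$\kappa:=(1-c)\left(\operatorname{Lip}(f)+\operatorname{Lip}_1(h)+\operatorname{Lip}_2(h)\right)<\frac{\sqrt3}{2}.$$ Let $N\ge 2$ and let $\mathcal P_N\colon\mathcal M_1(\mathbb T^N)\to\mathcal M_1(\mathbb T^N)$ be the transfer operator $$\mathcal P_N(\mu)(dx)=\int_{\mathbb T^N}\prod_{j=1}^N p\Big(x_j-f(u_j)-\frac1N\sum_{k=1}^N h(u_j,u_k)\Big)dx_j\,d\mu(u).$$ Then: 1. If $\mu\in\mathcal M_1(\mathbb T^N)$ is sub-Gaussian, then $\mathcal P_N(\mu)$ is sub-Gaussian. 2. For all $\mu_1,\mu_2\in\mathcal M_1(\mathbb T^N)$, $$W^1_N(\mathcal P_N(\mu_1),\mathcal P_N(\mu_2))\le\kappa\,W^1_N(\mu_1,\mu_2).$$ 3. In particular, $\mathcal P_N$ admits a unique fixed point $\rho_N\in\mathcal M_1(\mathbb T^N)$, and $\rho_N$ is sub-Gaussian.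
   Context: $\mathbb T=\mathbb R/\mathbb Z$ with the arc-length distance $d$ (so $d(x,y)=\min_{m\in\mathbb Z}|x-y-m|$), and $\mathcal M_1(X)$ is the set of Borel probability measures on $X$. $\operatorname{Lip}(f)$ is the Lipschitz constant of $f$ with respect to $d$. $\operatorname{Lip}_1(h)=\sup_{u_1\ne u_1',\,u_2}\frac{|h(u_1,u_2)-h(u_1',u_2)|}{d(u_1,u_1')}$, and $\operatorname{Lip}_2(h)$ is defined analogously in the second variable. $\mathcal P_N$ is the transfer operator of the Markov chain $x_i^{n+1}=f(x_i^n)+\frac1N\sum_{j=1}^N h(x_i^n,x_j^n)+\omega_i^n \bmod 1$, $i=1,\dots,N$, where the $\omega_i^n$ are i.i.d. with density $p$. For $g\colon\mathbb T^N\to\mathbb R$ and $1\le i\le N$, $$\operatorname{Lip}_i(g)=\sup_{x_{-i}\in\mathbb T^{N-1}}\sup_{x_i\ne x_i'}\frac{|g(x_i,x_{-i})-g(x_i',x_{-i})|}{d(x_i,x_i')},$$ where $x_{-i}$ is the vector of the coordinates other than the $i$-th; and $\operatorname{Lip}^N(g)=\sum_{i=1}^N\operatorname{Lip}_i(g)$. The $N$-dimensional Dobrushin-Wasserstein distance on $\mathcal M_1(\mathbb T^N)$ is $$W^1_N(\mu_1,\mu_2)=\sup_{g\colon\mathbb T^N\to\mathbb R,\ \operatorname{Lip}^N(g)\le1}\int g\,d(\mu_1-\mu_2).$$ A probability measure $\mu$ on $\mathbb T^N$ is sub-Gaussian if, for every Lipschitz observable $g\colon\mathbb T^N\to\mathbb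 R$ and every $\lambda\in\mathbb R$, $$\mathbb E_\mu\left[e^{\lambda(g-\mathbb E_\mu[g])}\right]\le\exp\Big(\frac{\lambda^2}{2}\sum_{i=1}^N\operatorname{Lip}_i(g)^2\Big).$$ *)

theory Defs
  imports "HOL-Probability.Probability"
begin

section \<open>The circle \<open>\<real>/\<int>\<close> with the arc-length distance\<close>

quotient_type circle = real / "\<lambda>x y :: real. x - y \<in> \<int>"
  morphisms rep_circle to_circle
proof (rule equivpI)
  show "reflp (\<lambda>x y :: real. x - y \<in> \<int>)"
    by (rule reflpI) simp
  show "symp (\<lambda>x y :: real. x - y \<in> \<int>)"
    by (rule sympI) (metis Ints_minus minus_diff_eq)
  show "transp (\<lambda>x y :: real. x - y \<in> \<int>)"
  proof (rule transpI)
    fix x y z :: real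
    assume "x - y \<in> \<int>" "y - z \<in> \<int>"
    then have "(x - y) + (y - z) \<in> \<int>" by (rule Ints_add)
    then show "x - z \<in> \<int>" by simp
  qed
qed

definition int_dist :: "real \<Rightarrow> real" where
  "int_dist t = (INF m::int. \<bar>t - of_int m\<bar>)"

text \<open>The infimum is a minimum, attained at the nearest integer.\<close>

lemma int_dist_le: "int_dist t \<le> \<bar>t - of_int m\<bar>"
  unfolding int_dist_def by (rule cINF_lower) (auto intro: bdd_belowI2[where m = 0])

lemma int_dist_eq_round: "int_dist t = \<bar>t - of_int (round t)\<bar>"
proof (rule antisym[OF int_dist_le])
  show "\<bar>t - of_int (round t)\<bar> \<le> int_dist t"
    unfolding int_dist_def by (rule cINF_greatest) (simp_all add: round_diff_minimal)
qed

lemma int_dist_add_int: "int_dist (t + of_int k) = int_dist t"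
proof -
  have *: "int_dist (s + of_int l) \<le> int_dist s" for s l
    using int_dist_le[of "s + of_int l" "round s + l"] by (simp add: int_dist_eq_round)
  show ?thesis using *[of t k] *[of "t + of_int k" "- k"] by simp
qed

lemma int_dist_triangle: "int_dist (s + t) \<le> int_dist s + int_dist t"
  using int_dist_le[of "s + t" "round s + round t"] by (simp add: int_dist_eq_round)

lemma int_dist_minus: "int_dist (- t) = int_dist t"
proof -
  have *: "int_dist (- s) \<le> int_dist s" for s
    using int_dist_le[of "- s" "- round s"] by (simp add: int_dist_eq_round)
  show ?thesis using *[of t] *[of "- t"] by simp
qed

instantiation circle :: metric_space
begin

lift_definition dist_circle :: "circle \<Rightarrow> circle \<Rightarrow> real"
  is "\<lambda>x y. int_dist (x - y)"
proof -
  fix x x' y y' :: real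
  assume "x - x' \<in> \<int>" "y - y' \<in> \<int>"
  then have "(x - x') - (y - y') \<in> \<int>" by (rule Ints_diff)
  then obtain k where "(x - x') - (y - y') = of_int k" by (rule Ints_cases)
  then have "x - y = (x' - y') + of_int k" by simp
  then show "int_dist (x - y) = int_dist (x' - y')" by (simp only: int_dist_add_int)
qed

definition uniformity_circle :: "(circle \<times> circle) filter" where
  "uniformity_circle = (INF e\<in>{0<..}. principal {(x, y). dist x y < e})"

definition open_circle :: "circle set \<Rightarrow> bool" where
  "open_circle U \<longleftrightarrow> (\<forall>x\<in>U. \<forall>\<^sub>F (x', y) in uniformity. x' = x \<longrightarrow> y \<in> U)"

instance
proof
  fix x y z :: circle
  show "dist x y = 0 \<longleftrightarrow> x = y"
  proof transfer
    fix x y :: real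
    show "int_dist (x - y) = 0 \<longleftrightarrow> x - y \<in> \<int>"
    proof
      assume "int_dist (x - y) = 0"
      then have "x - y = of_int (round (x - y))" by (simp add: int_dist_eq_round)
      then show "x - y \<in> \<int>" by (metis Ints_of_int)
    next
      assume "x - y \<in> \<int>"
      then show "int_dist (x - y) = 0"
        by (auto elim!: Ints_cases simp: int_dist_eq_round)
    qed
  qed
  show "dist x y \<le> dist x z + dist y z"
  proof transfer
    fix x y z :: real
    show "int_dist (x - y) \<le> int_dist (x - z) + int_dist (y - z)"
      using int_dist_triangle[of "x - z" "z - y"] int_dist_minus[of "y - z"] by simp
  qed
qed (rule uniformity_circle_def open_circle_def)+

end

text \<open>The representative in \<open>[0,1)\<close>; it is used to evaluate 1-periodic functions on the circle.\<close>

lift_definition circle_rep :: "circle \<Rightarrow> real" is "frac :: real \<Rightarrow> real"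
proof -
  fix x y :: real
  assume "x - y \<in> \<int>"
  then obtain k where "x - y = of_int k" by (rule Ints_cases)
  then have "x = y + of_int k" by simp
  then show "frac x = frac y" by (simp add: frac_def)
qed

section \<open>Measures on the circle and on the torus\<close>

definition circle_lebesgue :: "circle measure" where
  "circle_lebesgue = distr (restrict_space lborel {0..<1}) borel to_circle"

definition torus_lebesgue :: "(circle ^ 'n) measure" where
  "torus_lebesgue = distr (\<Pi>\<^sub>M i\<in>UNIV. circle_lebesgue) borel (\<lambda>x. \<chi> i. x i)"

definition borel_probs :: "'a::topological_space measure set" where
  "borel_probs = {\<mu>. sets \<mu> = sets borel \<and> prob_space \<mu>}"

section \<open>Lipschitz constants\<close>

definition is_lipschitz :: "('a::metric_space \<Rightarrow> real) \<Rightarrow> bool" where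
  "is_lipschitz g \<longleftrightarrow> (\<exists>L. L-lipschitz_on UNIV g)"

text \<open>The suprema below are taken in \<open>\<real>\<close>, where the supremum of an unbounded set is
  unspecified. They are meaningful for Lipschitz functions only, so each use has to be
  accompanied by \<^const>\<open>is_lipschitz\<close>; with the convention that the supremum of an unbounded
  set is \<open>\<infinity>\<close>, this amounts to requiring the constants to be finite.\<close>

definition Lip :: "(circle \<Rightarrow> real) \<Rightarrow> real" where
  "Lip f = Sup {\<bar>f u - f u'\<bar> / dist u u' | u u'. u \<noteq> u'}"

definition Lip1 :: "(circle \<times> circle \<Rightarrow> real) \<Rightarrow> real" where
  "Lip1 h = Sup {\<bar>h (u, v) - h (u', v)\<bar> / dist u u' | u u' v. u \<noteq> u'}"

definition Lip2 :: "(circle \<times> circle \<Rightarrow> real) \<Rightarrow> real" where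
  "Lip2 h = Sup {\<bar>h (u, v) - h (u, v')\<bar> / dist v v' | u v v'. v \<noteq> v'}"

definition Lip_coord :: "'n::finite \<Rightarrow> (circle ^ 'n \<Rightarrow> real) \<Rightarrow> real" where
  "Lip_coord i g = Sup {\<bar>g x - g x'\<bar> / dist (x $ i) (x' $ i) | x x'.
     x $ i \<noteq> x' $ i \<and> (\<forall>j. j \<noteq> i \<longrightarrow> x $ j = x' $ j)}"

definition Lip_sum :: "(circle ^ 'n::finite \<Rightarrow> real) \<Rightarrow> real" where
  "Lip_sum g = (\<Sum>i\<in>UNIV. Lip_coord i g)"

section \<open>Dobrushin-Wasserstein distance and sub-Gaussian measures\<close>

text \<open>For probability measures the set below is bounded, as a function with
  \<open>Lip_sum g \<le> 1\<close> has oscillation at most the diameter of the circle.\<close>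

definition W1 :: "(circle ^ 'n::finite) measure \<Rightarrow> (circle ^ 'n) measure \<Rightarrow> real" where
  "W1 \<mu> \<nu> = Sup {(\<integral>x. g x \<partial>\<mu>) - (\<integral>x. g x \<partial>\<nu>) | g. is_lipschitz g \<and> Lip_sum g \<le> 1}"

definition sub_gaussian :: "(circle ^ 'n::finite) measure \<Rightarrow> bool" where
  "sub_gaussian \<mu> \<longleftrightarrow> \<mu> \<in> borel_probs \<and>
     (\<forall>g (l::real). is_lipschitz g \<longrightarrow>
        (\<integral>x. exp (l * (g x - (\<integral>y. g y \<partial>\<mu>))) \<partial>\<mu>)
          \<le> exp (l\<^sup>2 / 2 * (\<Sum>i\<in>UNIV. (Lip_coord i g)\<^sup>2)))"

section \<open>The transfer operator\<close>

text \<open>\<open>p\<close> is meant to be 1-periodic, so that the choice of representative of \<open>x $ j\<close> is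
  irrelevant.\<close>

definition transfer_op ::
  "(circle \<Rightarrow> real) \<Rightarrow> (circle \<times> circle \<Rightarrow> real) \<Rightarrow> (real \<Rightarrow> real) \<Rightarrow>
     (circle ^ 'n::finite) measure \<Rightarrow> (circle ^ 'n) measure" where
  "transfer_op f h p \<mu> = density torus_lebesgue
     (\<lambda>x. \<integral>\<^sup>+u. (\<Prod>j\<in>UNIV. ennreal (p (circle_rep (x $ j) - f (u $ j)
                - 1 / real CARD('n) * (\<Sum>k\<in>UNIV. h (u $ j, u $ k))))) \<partial>\<mu>)"

end

theory Submission
  imports Defs
begin

text \<open>Let \<open>Q\<close> be the dual of the transfer operator: \<open>Q g u\<close> is the mean of \<open>g\<close> after one step from
  \<open>u\<close>. The uniform part of the noise, of mass \<open>c\<close>, forgets the current state, so averaging contracts each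
  \<open>Lip\<^sub>j g\<close> by \<open>1 - c\<close>; composed with the Lipschitz drift, the vector of coordinatewise Lipschitz
  constants is multiplied by the matrix with entries \<open>(1-c) ((Lip f + Lip\<^sub>1 h) \<delta>\<^sub>i\<^sub>j + Lip\<^sub>2 h / N)\<close>,
  whose \<open>\<ell>\<^sup>1\<close> and \<open>\<ell>\<^sup>2\<close> norms are both at most \<open>\<kappa>\<close>. The \<open>\<ell>\<^sup>1\<close> bound is the contraction of the
  Dobrushin-Wasserstein distance. The \<open>\<ell>\<^sup>2\<close> bound, together with McDiarmid's inequality for the noise,
  turns the sub-Gaussian constant \<open>K\<close> into \<open>1/4 + \<kappa>\<^sup>2 K\<close>, and \<open>1/4 + \<kappa>\<^sup>2 \<le> 1\<close>. As \<open>p > c\<close>, the chain satisfies a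
  Doeblin minorisation, which gives the fixed point, and iterating the affine map \<open>K \<mapsto> 1/4 + 3/4 K\<close> along
  the fixed point makes it sub-Gaussian.\<close>

section \<open>Coordinates and Lebesgue measure on the circle and the torus\<close>

lemma dist_to_circle: "dist (to_circle x) (to_circle y) = int_dist (x - y)"
  by (simp add: dist_circle.abs_eq)

lemma dist_to_circle_le: "dist (to_circle x) (to_circle y) \<le> \<bar>x - y\<bar>"
  using int_dist_le[of "x - y" 0] by (simp add: dist_to_circle)

lemma to_circle_add_int: "to_circle (x + of_int k) = to_circle x"
  by (simp add: circle.abs_eq_iff)

lemma circle_rep_to_circle: "circle_rep (to_circle x) = frac x"
  by (simp add: circle_rep.abs_eq)

lemma to_circle_frac [simp]: "to_circle (frac x) = to_circle x"
  by (simp add: circle.abs_eq_iff frac_def)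

lemma to_circle_circle_rep [simp]: "to_circle (circle_rep x) = x"
  by (induct x rule: circle.abs_induct) (simp add: circle_rep_to_circle)

lemma circle_rep_range: "0 \<le> circle_rep x" "circle_rep x < 1"
  by (induct x rule: circle.abs_induct; simp add: circle_rep_to_circle frac_lt_1)+

text \<open>The diameter is 1/2; the bound 1 is all that is used later, and it is where the summand
  1/4 in the recursion for the sub-Gaussian constant comes from.\<close>

lemma dist_circle_le_1: "dist (x::circle) y \<le> 1"
  using dist_to_circle[of "circle_rep x" "circle_rep y"]
    of_int_round_abs_le[of "circle_rep x - circle_rep y"]
  by (simp add: int_dist_eq_round abs_minus_commute)

lemma continuous_on_to_circle: "continuous_on A to_circle"
  unfolding continuous_on_iff
  using dist_to_circle_le by (metis dist_real_def order_le_less_trans)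

lemma to_circle_measurable [measurable]: "to_circle \<in> borel_measurable borel"
  by (intro borel_measurable_continuous_onI continuous_on_to_circle)

lemma circle_rep_measurable [measurable]: "circle_rep \<in> borel_measurable borel"
proof (rule borel_measurableI_le)
  fix a :: real
  let ?S = "circle_rep -` {..a}"
  have "?S \<in> sets borel"
  proof (cases "0 \<le> a \<and> a < 1")
    case True
    have "?S = to_circle ` {0..a}"
    proof (intro equalityI subsetI)
      fix x assume "x \<in> ?S"
      then show "x \<in> to_circle ` {0..a}"
        by (intro image_eqI[where x = "circle_rep x"]) (auto simp: circle_rep_range)
    next
      fix x assume "x \<in> to_circle ` {0..a}"
      then obtain t where "x = to_circle t" "0 \<le> t" "t \<le> a" by auto
      moreover have "frac t = t" using calculation True by (simp add: frac_eq)
      ultimately show "x \<in> ?S" by (simp add: circle_rep_to_circle)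
    qed
    moreover have "compact (to_circle ` {0..a})"
      by (intro compact_continuous_image continuous_on_to_circle) simp
    ultimately show ?thesis by (simp add: borel_closed compact_imp_closed)
  next
    case False
    then have "a < 0 \<or> a \<ge> 1" by auto
    then have "?S = {} \<or> ?S = UNIV"
      using circle_rep_range by (auto simp: vimage_def) (smt (verit) circle_rep_range)+
    then show ?thesis by auto
  qed
  then show "{x \<in> space borel. circle_rep x \<le> a} \<in> sets borel"
    by (simp add: vimage_def)
qed

text \<open>For real coordinates the product sigma-algebra is the Borel one, so continuity gives
  measurability into the torus with its topological Borel sets.\<close>

lemma vec_to_circle_measurable:
  "(\<lambda>w. \<chi> j. to_circle (w j)) \<in> (\<Pi>\<^sub>M j\<in>(UNIV::'n::finite set). (borel :: real measure)) \<rightarrow>\<^sub>M (borel :: (circle ^ 'n) measure)"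
proof -
  have "continuous_on UNIV (\<lambda>w::'n \<Rightarrow> real. \<chi> j. to_circle (w j))"
    by (intro continuous_on_vec_lambda continuous_on_compose2[OF continuous_on_to_circle[of UNIV]]
        continuous_on_product_coordinates) auto
  then have "(\<lambda>w::'n \<Rightarrow> real. \<chi> j. to_circle (w j)) \<in> borel_measurable borel"
    by (rule borel_measurable_continuous_onI)
  then show ?thesis
    by (simp add: measurable_cong_sets[OF sets_PiM_equal_borel refl])
qed

text \<open>Each circle-valued coordinate is lifted to its real representative and projected back,
  which reduces the claim to real coordinates.\<close>

lemma vec_circle_measurable [measurable (raw)]:
  fixes X :: "'n::finite \<Rightarrow> 'a \<Rightarrow> circle"
  assumes [measurable]: "\<And>j. X j \<in> borel_measurable M"
  shows "(\<lambda>w. \<chi> j. X j w) \<in> borel_measurable M"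
proof -
  have "(\<lambda>w. \<lambda>j\<in>UNIV. circle_rep (X j w)) \<in> M \<rightarrow>\<^sub>M (\<Pi>\<^sub>M j\<in>(UNIV::'n set). borel)"
    by (intro measurable_restrict) simp
  from measurable_compose[OF this vec_to_circle_measurable]
  show ?thesis by simp
qed

lemma vec_nth_measurable [measurable]:
  "(\<lambda>x. x $ i) \<in> borel_measurable (borel :: ('a::metric_space ^ 'n::finite) measure)"
  by (intro borel_measurable_continuous_onI continuous_on_component continuous_on_id)

lemma sets_circle_lebesgue [measurable_cong]: "sets circle_lebesgue = sets borel"
  by (simp add: circle_lebesgue_def)

lemma sets_torus_lebesgue [measurable_cong]: "sets (torus_lebesgue :: (circle ^ 'n::finite) measure) = sets borel"
  by (simp add: torus_lebesgue_def)

lemma nn_integral_circle_lebesgue: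
  assumes [measurable]: "G \<in> borel_measurable borel"
  shows "(\<integral>\<^sup>+x. G x \<partial>circle_lebesgue) = (\<integral>\<^sup>+x\<in>{0..<1}. G (to_circle x) \<partial>lborel)"
  unfolding circle_lebesgue_def
  by (subst nn_integral_distr) (simp_all add: nn_integral_restrict_space measurable_restrict_space1)

lemma prob_space_circle_lebesgue: "prob_space circle_lebesgue"
proof
  have "emeasure circle_lebesgue (space circle_lebesgue) = (\<integral>\<^sup>+x. 1 \<partial>circle_lebesgue)"
    by simp
  also have "\<dots> = 1" by (subst nn_integral_circle_lebesgue) simp_all
  finally show "emeasure circle_lebesgue (space circle_lebesgue) = 1" .
qed

lemma torus_map_measurable:
  "(\<lambda>x. \<chi> i. x i) \<in> (\<Pi>\<^sub>M i\<in>(UNIV::'n::finite set). circle_lebesgue) \<rightarrow>\<^sub>M (borel :: (circle ^ 'n) measure)"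
  by measurable

lemma prob_space_torus_lebesgue: "prob_space (torus_lebesgue :: (circle ^ 'n::finite) measure)"
  unfolding torus_lebesgue_def
  by (intro prob_space.prob_space_distr prob_space_PiM prob_space_circle_lebesgue
      torus_map_measurable)

text \<open>Splitting off the integer part of \<open>s\<close> reduces to \<open>0 \<le> s < 1\<close>, where \<open>{s..<s+1}\<close> is cut
  at \<open>1\<close> and its right-hand part is shifted back by a period.\<close>

lemma nn_integral_periodic_shift:
  fixes F :: "real \<Rightarrow> ennreal"
  assumes [measurable]: "F \<in> borel_measurable borel" and per: "\<And>x k. F (x + of_int k) = F x"
  shows "(\<integral>\<^sup>+x\<in>{0..<1}. F (x + s) \<partial>lborel) = (\<integral>\<^sup>+x\<in>{0..<1}. F x \<partial>lborel)"
proof -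
  define r where "r = frac s"
  have r: "0 \<le> r" "r < 1" by (simp_all add: r_def frac_lt_1)
  have shift: "(\<integral>\<^sup>+x. F (x + t) * indicator {a..<b} x \<partial>lborel)
      = (\<integral>\<^sup>+x. F x * indicator {a+t..<b+t} x \<partial>lborel)" for a b t
    by (subst (2) nn_integral_real_affine[where c = 1 and t = t])
       (auto intro!: nn_integral_cong simp: indicator_def add.commute)
  have split: "(\<integral>\<^sup>+x. F x * indicator {a..<b} x \<partial>lborel)
      = (\<integral>\<^sup>+x. F x * indicator {a..<m} x \<partial>lborel) + (\<integral>\<^sup>+x. F x * indicator {m..<b} x \<partial>lborel)"
    if "a \<le> m" "m \<le> b" for a b m
    using that
    by (subst nn_integral_add[symmetric])
       (auto intro!: nn_integral_cong simp: indicator_def)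
  have per1: "F (x + 1) = F x" for x using per[of x 1] by simp
  have "F (x + s) = F (x + r)" for x
    using per[of "x + r" "\<lfloor>s\<rfloor>"] by (simp add: r_def frac_def)
  then have "(\<integral>\<^sup>+x\<in>{0..<1}. F (x + s) \<partial>lborel) = (\<integral>\<^sup>+x\<in>{0..<1}. F (x + r) \<partial>lborel)"
    by simp
  also have "\<dots> = (\<integral>\<^sup>+x. F x * indicator {r..<1+r} x \<partial>lborel)"
    using shift[of r 0 1] by simp
  also have "\<dots> = (\<integral>\<^sup>+x. F x * indicator {r..<1} x \<partial>lborel) + (\<integral>\<^sup>+x. F x * indicator {1..<1+r} x \<partial>lborel)"
    using r by (intro split) auto
  also have "(\<integral>\<^sup>+x. F x * indicator {1..<1+r} x \<partial>lborel) = (\<integral>\<^sup>+x. F x * indicator {0..<r} x \<partial>lborel)"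
    using shift[of 1 0 r] by (simp add: per1 add.commute)
  also have "(\<integral>\<^sup>+x. F x * indicator {r..<1} x \<partial>lborel) + (\<integral>\<^sup>+x. F x * indicator {0..<r} x \<partial>lborel)
      = (\<integral>\<^sup>+x. F x * indicator {0..<1} x \<partial>lborel)"
    using r split[of 0 r 1] by (simp add: add.commute)
  finally show ?thesis .
qed

section \<open>Lipschitz constants\<close>

lemma dist_vec_single:
  fixes x x' :: "'a::metric_space ^ 'n::finite"
  assumes "\<And>j. j \<noteq> i \<Longrightarrow> x $ j = x' $ j"
  shows "dist x x' = dist (x $ i) (x' $ i)"
proof -
  have "L2_set (\<lambda>j. dist (x $ j) (x' $ j)) UNIV = sqrt (\<Sum>j\<in>UNIV. if j = i then (dist (x $ i) (x' $ i))\<^sup>2 else 0)"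
    unfolding L2_set_def by (intro arg_cong[where f = sqrt] sum.cong) (auto simp: assms)
  then show ?thesis by (simp add: dist_vec_def)
qed

text \<open>Ensures that the suprema of difference quotients run over nonempty sets, and supplies
  the positive distance that makes Lipschitz constants nonnegative.\<close>

lemma circle_two_points: "\<exists>u u'::circle. u \<noteq> u'"
proof -
  have "frac (1/2 :: real) = 1/2" by (subst frac_eq) simp
  then have "circle_rep (to_circle (1/2)) \<noteq> circle_rep (to_circle 0)"
    by (simp add: circle_rep_to_circle)
  then have "to_circle (1/2) \<noteq> to_circle 0" by metis
  then show ?thesis by blast
qed

text \<open>A global Lipschitz constant bounds the difference quotients, so the real supremum really
  is an upper bound; equal points are trivial. The same scheme serves \<open>Lip1\<close>,
  \<open>Lip2\<close> and \<open>Lip_coord\<close>.\<close>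

lemma le_Lip_mult:
  assumes "is_lipschitz f"
  shows "\<bar>f u - f u'\<bar> \<le> Lip f * dist u u'"
proof (cases "u = u'")
  case False
  obtain L where L: "L-lipschitz_on UNIV f" using assms by (auto simp: is_lipschitz_def)
  have "bdd_above {\<bar>f u - f u'\<bar> / dist u u' | u u'. u \<noteq> u'}"
    by (rule bdd_aboveI[where M = L]) (use L in \<open>auto simp: lipschitz_on_def dist_real_def divide_le_eq\<close>)
  then have "\<bar>f u - f u'\<bar> / dist u u' \<le> Lip f"
    unfolding Lip_def by (rule cSup_upper[rotated]) (use False in blast)
  with False show ?thesis by (simp add: divide_le_eq)
qed simp

lemma le_Lip1_mult:
  assumes "is_lipschitz h"
  shows "\<bar>h (u, v) - h (u', v)\<bar> \<le> Lip1 h * dist u u'"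
proof (cases "u = u'")
  case False
  obtain L where L: "L-lipschitz_on UNIV h" using assms by (auto simp: is_lipschitz_def)
  have "\<bar>h (u, v) - h (u', v)\<bar> \<le> L * dist u u'" for u u' v
    using lipschitz_onD[OF L, of "(u, v)" "(u', v)"] by (simp add: dist_real_def dist_Pair_Pair)
  then have "bdd_above {\<bar>h (u, v) - h (u', v)\<bar> / dist u u' | u u' v. u \<noteq> u'}"
    by (intro bdd_aboveI[where M = L]) (auto simp: divide_le_eq)
  then have "\<bar>h (u, v) - h (u', v)\<bar> / dist u u' \<le> Lip1 h"
    unfolding Lip1_def by (rule cSup_upper[rotated]) (use False in blast)
  with False show ?thesis by (simp add: divide_le_eq)
qed simp

lemma le_Lip2_mult:
  assumes "is_lipschitz h"
  shows "\<bar>h (u, v) - h (u, v')\<bar> \<le> Lip2 h * dist v v'"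
proof (cases "v = v'")
  case False
  obtain L where L: "L-lipschitz_on UNIV h" using assms by (auto simp: is_lipschitz_def)
  have "\<bar>h (u, v) - h (u, v')\<bar> \<le> L * dist v v'" for v v' u
    using lipschitz_onD[OF L, of "(u, v)" "(u, v')"] by (simp add: dist_real_def dist_Pair_Pair)
  then have "bdd_above {\<bar>h (u, v) - h (u, v')\<bar> / dist v v' | u v v'. v \<noteq> v'}"
    by (intro bdd_aboveI[where M = L]) (auto simp: divide_le_eq)
  then have "\<bar>h (u, v) - h (u, v')\<bar> / dist v v' \<le> Lip2 h"
    unfolding Lip2_def by (rule cSup_upper[rotated]) (use False in blast)
  with False show ?thesis by (simp add: divide_le_eq)
qed simp

lemma nonneg_if_abs_le_mult_dist:
  assumes "\<And>u u'::circle. \<bar>F u u' :: real\<bar> \<le> L * dist u u'"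
  shows "0 \<le> L"
proof -
  obtain u u' :: circle where "u \<noteq> u'" using circle_two_points by blast
  moreover have "0 \<le> L * dist u u'" using assms[of u u'] by linarith
  ultimately show ?thesis by (simp add: zero_le_mult_iff)
qed

lemma Lip_nonneg: "is_lipschitz f \<Longrightarrow> 0 \<le> Lip f"
  by (rule nonneg_if_abs_le_mult_dist[OF le_Lip_mult])

lemma Lip1_nonneg: "is_lipschitz h \<Longrightarrow> 0 \<le> Lip1 h"
  by (rule nonneg_if_abs_le_mult_dist[OF le_Lip1_mult[where v = undefined]])

lemma Lip2_nonneg: "is_lipschitz h \<Longrightarrow> 0 \<le> Lip2 h"
  by (rule nonneg_if_abs_le_mult_dist[OF le_Lip2_mult[where u = undefined]])

lemma le_Lip_coord_mult:
  fixes g :: "circle ^ 'n::finite \<Rightarrow> real"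
  assumes "is_lipschitz g" and eq: "\<And>j. j \<noteq> i \<Longrightarrow> x $ j = x' $ j"
  shows "\<bar>g x - g x'\<bar> \<le> Lip_coord i g * dist (x $ i) (x' $ i)"
proof (cases "x $ i = x' $ i")
  case True
  then have "x = x'" using eq by (metis vec_eq_iff)
  then show ?thesis by simp
next
  case False
  obtain L where L: "L-lipschitz_on UNIV g" using assms by (auto simp: is_lipschitz_def)
  have "\<bar>g x - g x'\<bar> \<le> L * dist (x $ i) (x' $ i)"
    if "\<forall>j. j \<noteq> i \<longrightarrow> x $ j = x' $ j" for x x'
    using lipschitz_onD[OF L, of x x'] dist_vec_single[of i x x'] that by (simp add: dist_real_def)
  then have "bdd_above {\<bar>g x - g x'\<bar> / dist (x $ i) (x' $ i) | x x'.
     x $ i \<noteq> x' $ i \<and> (\<forall>j. j \<noteq> i \<longrightarrow> x $ j = x' $ j)}"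
    by (intro bdd_aboveI[where M = L]) (auto simp: divide_le_eq)
  then have "\<bar>g x - g x'\<bar> / dist (x $ i) (x' $ i) \<le> Lip_coord i g"
    unfolding Lip_coord_def by (rule cSup_upper[rotated]) (use False eq in blast)
  with False show ?thesis by (simp add: divide_le_eq)
qed

lemma Lip_coord_le:
  fixes g :: "circle ^ 'n::finite \<Rightarrow> real"
  assumes "\<And>x x'. (\<And>j. j \<noteq> i \<Longrightarrow> x $ j = x' $ j) \<Longrightarrow> \<bar>g x - g x'\<bar> \<le> C * dist (x $ i) (x' $ i)"
  shows "Lip_coord i g \<le> C"
proof -
  obtain u u' :: circle where "u \<noteq> u'" using circle_two_points by blast
  \<comment> \<open>Two vectors that differ in coordinate \<open>i\<close> only. The first is
    constantly \<open>u\<close>; the conditional merely gives both the same shape.\<close>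
  then have ne: "(\<chi> j. if j = i then u else u) $ i \<noteq> (\<chi> j. if j = i then u' else u) $ i \<and>
     (\<forall>j. j \<noteq> i \<longrightarrow> (\<chi> j. if j = i then u else u) $ j = (\<chi> j. if j = i then u' else u) $ j)" by simp
  show ?thesis unfolding Lip_coord_def
  proof (rule cSup_least)
    show "{\<bar>g x - g x'\<bar> / dist (x $ i) (x' $ i) | x x'.
       x $ i \<noteq> x' $ i \<and> (\<forall>j. j \<noteq> i \<longrightarrow> x $ j = x' $ j)} \<noteq> {}"
      using ne by blast
  qed (use assms in \<open>auto simp: divide_le_eq\<close>)
qed

lemma Lip_coord_nonneg:
  fixes g :: "circle ^ 'n::finite \<Rightarrow> real"
  assumes "is_lipschitz g"
  shows "0 \<le> Lip_coord i g"
proof (rule nonneg_if_abs_le_mult_dist)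
  fix u u' :: circle
  show "\<bar>g (\<chi> j. if j = i then u else undefined) - g (\<chi> j. if j = i then u' else undefined)\<bar>
    \<le> Lip_coord i g * dist u u'"
    using le_Lip_coord_mult[OF assms, of i "\<chi> j. if j = i then u else undefined"
        "\<chi> j. if j = i then u' else undefined"] by simp
qed

text \<open>Coordinates are switched from \<open>x\<close> to \<open>y\<close> one at a time, by
  induction on the set already switched. It serves both for observables on the torus and for means
  as functions of the shift.\<close>

lemma telescope_coordinates:
  fixes G :: "('n::finite \<Rightarrow> 'a) \<Rightarrow> real" and d :: "'n \<Rightarrow> 'a \<Rightarrow> 'a \<Rightarrow> real"
  assumes "\<And>i x a. \<bar>G x - G (x(i := a))\<bar> \<le> d i (x i) a"
  shows "\<bar>G x - G y\<bar> \<le> (\<Sum>i\<in>UNIV. d i (x i) (y i))"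
proof -
  have "\<bar>G x - G (\<lambda>j. if j \<in> S then y j else x j)\<bar> \<le> (\<Sum>i\<in>S. d i (x i) (y i))" if "finite S" for S
    using that
  proof induction
    case (insert i S)
    let ?z = "\<lambda>j. if j \<in> S then y j else x j"
    have "(\<lambda>j. if j \<in> insert i S then y j else x j) = ?z(i := y i)" by auto
    moreover have "?z i = x i" using insert by simp
    ultimately show ?case using assms[of ?z i "y i"] insert by simp
  qed simp
  from this[of UNIV] show ?thesis by simp
qed

lemma abs_diff_le_sum_Lip_coord:
  fixes g :: "circle ^ 'n::finite \<Rightarrow> real"
  assumes "is_lipschitz g"
  shows "\<bar>g x - g y\<bar> \<le> (\<Sum>i\<in>UNIV. Lip_coord i g * dist (x $ i) (y $ i))"
proof -
  have "\<bar>g (vec_lambda z) - g (vec_lambda (z(i := a)))\<bar> \<le> Lip_coord i g * dist (z i) a"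
    for z :: "'n \<Rightarrow> circle" and i a
    using le_Lip_coord_mult[OF assms, of i "vec_lambda z" "vec_lambda (z(i := a))"] by simp
  from telescope_coordinates[of "\<lambda>z. g (vec_lambda z)", OF this, of "vec_nth x" "vec_nth y"]
  show ?thesis by simp
qed

lemma abs_diff_le_Lip_sum:
  fixes g :: "circle ^ 'n::finite \<Rightarrow> real"
  assumes "is_lipschitz g"
  shows "\<bar>g x - g y\<bar> \<le> Lip_sum g"
proof -
  have "(\<Sum>i\<in>UNIV. Lip_coord i g * dist (x $ i) (y $ i)) \<le> (\<Sum>i\<in>UNIV. Lip_coord i g * 1)"
    by (intro sum_mono mult_left_mono dist_circle_le_1 Lip_coord_nonneg assms)
  then show ?thesis using abs_diff_le_sum_Lip_coord[OF assms, of x y] by (simp add: Lip_sum_def)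
qed

text \<open>The way to bound the constants of a derived observable: each coordinate distance is at
  most the full distance, and all terms but the \<open>i\<close>-th vanish when only coordinate
  \<open>i\<close> moves.\<close>

lemma is_lipschitz_if_sum_bound:
  fixes g :: "circle ^ 'n::finite \<Rightarrow> real"
  assumes "\<And>i. 0 \<le> m i" and "\<And>x y. \<bar>g x - g y\<bar> \<le> (\<Sum>i\<in>UNIV. m i * dist (x $ i) (y $ i))"
  shows "is_lipschitz g" and "Lip_coord i g \<le> m i"
proof -
  have "(\<Sum>i\<in>UNIV. m i)-lipschitz_on UNIV g"
  proof (rule lipschitz_onI)
    fix x y :: "circle ^ 'n"
    have "(\<Sum>i\<in>UNIV. m i * dist (x $ i) (y $ i)) \<le> (\<Sum>i\<in>UNIV. m i * dist x y)"
      by (intro sum_mono mult_left_mono dist_vec_nth_le assms)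
    then show "dist (g x) (g y) \<le> (\<Sum>i\<in>UNIV. m i) * dist x y"
      using assms(2)[of x y] by (simp add: dist_real_def sum_distrib_right)
  qed (simp add: assms sum_nonneg)
  then show "is_lipschitz g" by (auto simp: is_lipschitz_def)
  show "Lip_coord i g \<le> m i"
  proof (rule Lip_coord_le)
    fix x x' :: "circle ^ 'n" assume "\<And>j. j \<noteq> i \<Longrightarrow> x $ j = x' $ j"
    then have "(\<Sum>j\<in>UNIV. m j * dist (x $ j) (x' $ j)) = (\<Sum>j\<in>UNIV. if j = i then m i * dist (x $ i) (x' $ i) else 0)"
      by (intro sum.cong) auto
    then show "\<bar>g x - g x'\<bar> \<le> m i * dist (x $ i) (x' $ i)"
      using assms(2)[of x x'] by simp
  qed
qed

lemma is_lipschitz_measurable: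
  "is_lipschitz g \<Longrightarrow> g \<in> borel_measurable borel"
  by (auto simp: is_lipschitz_def intro: borel_measurable_continuous_onI dest: lipschitz_on_continuous_on)

lemma lipschitz_abs_le:
  fixes g :: "circle ^ 'n::finite \<Rightarrow> real"
  assumes "is_lipschitz g"
  shows "\<bar>g x\<bar> \<le> \<bar>g undefined\<bar> + Lip_sum g"
  using abs_diff_le_Lip_sum[OF assms, of x undefined] by linarith

lemma integrable_lipschitz:
  fixes g :: "circle ^ 'n::finite \<Rightarrow> real"
  assumes "is_lipschitz g" "\<mu> \<in> borel_probs"
  shows "integrable \<mu> g"
proof -
  interpret prob_space \<mu> using assms by (simp add: borel_probs_def)
  have [measurable_cong]: "sets \<mu> = sets borel" using assms by (simp add: borel_probs_def)
  have [measurable]: "g \<in> borel_measurable borel" using assms by (simp add: is_lipschitz_measurable)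
  show ?thesis
    by (rule integrable_const_bound[where B = "\<bar>g undefined\<bar> + Lip_sum g"])
       (simp_all add: lipschitz_abs_le assms(1))
qed

lemma is_lipschitz_const: "is_lipschitz (\<lambda>_. a)"
  by (auto simp: is_lipschitz_def lipschitz_on_def intro!: exI[of _ 0])

lemma is_lipschitz_scale:
  fixes g :: "circle ^ 'n::finite \<Rightarrow> real"
  assumes "is_lipschitz g" "0 \<le> s"
  shows "is_lipschitz (\<lambda>x. s * g x)" "Lip_sum (\<lambda>x. s * g x) \<le> s * Lip_sum g"
proof -
  have "\<bar>s * g x - s * g y\<bar> \<le> (\<Sum>i\<in>UNIV. (s * Lip_coord i g) * dist (x $ i) (y $ i))" for x y
  proof -
    have "\<bar>s * g x - s * g y\<bar> = s * \<bar>g x - g y\<bar>"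
      using assms(2) by (simp add: abs_mult flip: right_diff_distrib)
    also have "\<dots> \<le> s * (\<Sum>i\<in>UNIV. Lip_coord i g * dist (x $ i) (y $ i))"
      by (intro mult_left_mono abs_diff_le_sum_Lip_coord assms)
    finally show ?thesis by (simp add: sum_distrib_left mult.assoc)
  qed
  note * = is_lipschitz_if_sum_bound[where m = "\<lambda>i. s * Lip_coord i g", OF _ this]
  show "is_lipschitz (\<lambda>x. s * g x)" by (rule *) (simp add: assms Lip_coord_nonneg)
  show "Lip_sum (\<lambda>x. s * g x) \<le> s * Lip_sum g"
    unfolding Lip_sum_def sum_distrib_left
    by (intro sum_mono *(2)) (simp add: assms Lip_coord_nonneg)
qed

section \<open>Differences of integrals and the Dobrushin-Wasserstein distance\<close>

lemma integral_diff_le_Lip_sum: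
  fixes g :: "circle ^ 'n::finite \<Rightarrow> real"
  assumes "is_lipschitz g" "\<mu> \<in> borel_probs" "\<nu> \<in> borel_probs"
  shows "(\<integral>x. g x \<partial>\<mu>) - (\<integral>x. g x \<partial>\<nu>) \<le> 2 * Lip_sum g"
proof -
  interpret \<mu>: prob_space \<mu> using assms by (simp add: borel_probs_def)
  interpret \<nu>: prob_space \<nu> using assms by (simp add: borel_probs_def)
  \<comment> \<open>Both integrals are compared with this single value, which costs the factor 2.
    The bound serves for finiteness of the supremum in \<open>W1\<close> and for observables with
    \<open>Lip_sum g \<le> 0\<close>.\<close>
  let ?a = "g undefined"
  note bd = abs_diff_le_Lip_sum[OF assms(1), of _ undefined]
  have "(\<integral>x. g x \<partial>\<mu>) \<le> (\<integral>x. ?a + Lip_sum g \<partial>\<mu>)"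
    using bd by (intro integral_mono integrable_lipschitz is_lipschitz_const assms) (auto simp: abs_le_iff algebra_simps)
  moreover have "(\<integral>x. ?a - Lip_sum g \<partial>\<nu>) \<le> (\<integral>x. g x \<partial>\<nu>)"
    using bd by (intro integral_mono integrable_lipschitz is_lipschitz_const assms) (auto simp: abs_le_iff algebra_simps)
  ultimately show ?thesis by (simp add: \<mu>.prob_space \<nu>.prob_space)
qed

lemma le_W1:
  fixes g :: "circle ^ 'n::finite \<Rightarrow> real"
  assumes "is_lipschitz g" "Lip_sum g \<le> 1" "\<mu> \<in> borel_probs" "\<nu> \<in> borel_probs"
  shows "(\<integral>x. g x \<partial>\<mu>) - (\<integral>x. g x \<partial>\<nu>) \<le> W1 \<mu> \<nu>"
  unfolding W1_def
proof (rule cSup_upper)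
  show "bdd_above {(\<integral>x. g x \<partial>\<mu>) - (\<integral>x. g x \<partial>\<nu>) | g. is_lipschitz g \<and> Lip_sum g \<le> 1}"
  proof (rule bdd_aboveI[where M = 2])
    fix r assume "r \<in> {(\<integral>x. g x \<partial>\<mu>) - (\<integral>x. g x \<partial>\<nu>) | g. is_lipschitz g \<and> Lip_sum g \<le> 1}"
    then obtain g where g: "r = (\<integral>x. g x \<partial>\<mu>) - (\<integral>x. g x \<partial>\<nu>)" "is_lipschitz g" "Lip_sum g \<le> 1" by blast
    show "r \<le> 2" using integral_diff_le_Lip_sum[OF g(2) assms(3,4)] g by linarith
  qed
qed (use assms in blast)

text \<open>Homogeneity: \<open>g\<close> divided by \<open>K\<close> is admissible in the supremum.
  For \<open>K = 0\<close> the crude bound already makes the difference nonpositive.\<close>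

lemma integral_diff_le_W1:
  fixes g :: "circle ^ 'n::finite \<Rightarrow> real"
  assumes g: "is_lipschitz g" "Lip_sum g \<le> K" and mn: "\<mu> \<in> borel_probs" "\<nu> \<in> borel_probs"
  shows "(\<integral>x. g x \<partial>\<mu>) - (\<integral>x. g x \<partial>\<nu>) \<le> K * W1 \<mu> \<nu>"
proof -
  have "0 \<le> Lip_sum g" by (simp add: Lip_sum_def sum_nonneg Lip_coord_nonneg g)
  then have "0 \<le> K" using g by simp
  show ?thesis
  proof (cases "K = 0")
    case True
    then show ?thesis using integral_diff_le_Lip_sum[OF g(1) mn] g(2) by simp
  next
    case False
    with \<open>0 \<le> K\<close> have K: "0 < K" by simp
    have "Lip_sum (\<lambda>x. (1 / K) * g x) \<le> (1 / K) * Lip_sum g"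
      using K by (intro is_lipschitz_scale g) simp
    also have "\<dots> \<le> 1" using g K by simp
    finally have "(\<integral>x. (1 / K) * g x \<partial>\<mu>) - (\<integral>x. (1 / K) * g x \<partial>\<nu>) \<le> W1 \<mu> \<nu>"
      using K by (intro le_W1 is_lipschitz_scale g mn) auto
    then have "(1 / K) * ((\<integral>x. g x \<partial>\<mu>) - (\<integral>x. g x \<partial>\<nu>)) \<le> W1 \<mu> \<nu>"
      by (simp add: right_diff_distrib)
    with K show ?thesis by (simp add: field_simps)
  qed
qed

section \<open>Exponential moments and stationary measures\<close>

lemma (in prob_space) bounded_expectation:
  fixes f :: "'a \<Rightarrow> real"
  assumes [measurable]: "f \<in> borel_measurable M" and bd: "\<And>x. x \<in> space M \<Longrightarrow> \<bar>f x\<bar> \<le> B"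
  shows "integrable M f" and "\<bar>expectation f\<bar> \<le> B"
proof -
  show int: "integrable M f"
    by (rule integrable_const_bound[where B = B]) (use bd in \<open>auto intro!: AE_I2\<close>)
  have "expectation f \<le> B" "- B \<le> expectation f"
    using bd by (intro integral_le_const integral_ge_const int AE_I2; force simp: abs_le_iff)+
  then show "\<bar>expectation f\<bar> \<le> B" by simp
qed

text \<open>An oscillation bound \<open>d\<close> confines \<open>f\<close> to the interval of
  length \<open>d\<close> starting at its infimum, so Hoeffding's lemma applies for
  \<open>l > 0\<close>. Negative \<open>l\<close> is treated by passing to
  \<open>- f\<close>.\<close>

lemma (in prob_space) Hoeffding_exp_bound:
  fixes f :: "'a \<Rightarrow> real"
  assumes [measurable]: "f \<in> borel_measurable M"
    and osc: "\<And>x y. x \<in> space M \<Longrightarrow> y \<in> space M \<Longrightarrow> f x - f y \<le> d"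
  shows "(\<integral>\<^sup>+x. ennreal (exp (l * (f x - expectation f))) \<partial>M) \<le> ennreal (exp (l\<^sup>2 * d\<^sup>2 / 8))"
proof -
  have pos: "(\<integral>\<^sup>+x. ennreal (exp (l * (f x - expectation f))) \<partial>M) \<le> ennreal (exp (l\<^sup>2 * d\<^sup>2 / 8))"
    if [measurable]: "f \<in> borel_measurable M"
      and osc: "\<And>x y. x \<in> space M \<Longrightarrow> y \<in> space M \<Longrightarrow> f x - f y \<le> d" and "l > 0"
    for f :: "'a \<Rightarrow> real" and l
  proof -
    define a where "a = (INF x\<in>space M. f x)"
    obtain x0 where x0: "x0 \<in> space M" using not_empty by blast
    have "bdd_below (f ` space M)"
      by (rule bdd_belowI2[where m = "f x0 - d"]) (use osc[OF x0] in force)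
    then have "a \<le> f x" if "x \<in> space M" for x
      unfolding a_def by (rule cINF_lower) fact
    moreover have "f x - d \<le> a" if "x \<in> space M" for x
      unfolding a_def by (rule cINF_greatest) (use osc[OF that] not_empty in force)+
    ultimately interpret interval_bounded_random_variable M f a "a + d"
      by unfold_locales (auto intro!: AE_I2 simp: algebra_simps)
    show ?thesis using Hoeffdings_lemma_nn_integral[OF \<open>l > 0\<close>] by simp
  qed
  consider "l > 0" | "l = 0" | "l < 0" by linarith
  then show ?thesis
  proof cases
    case 3
    have "(\<integral>\<^sup>+x. ennreal (exp ((- l) * ((- f x) - expectation (\<lambda>x. - f x)))) \<partial>M)
      \<le> ennreal (exp ((- l)\<^sup>2 * d\<^sup>2 / 8))"
      by (rule pos) (use osc 3 in \<open>auto simp: algebra_simps\<close>)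
    then show ?thesis by (simp add: algebra_simps)
  qed (use pos[of f l] osc emeasure_space_1 in simp_all)
qed

text \<open>The exponential moment bound behind McDiarmid's inequality: integrate out the coordinates
  one at a time, applying Hoeffding's lemma to each.\<close>

lemma (in product_prob_space) McDiarmid_exp_bound:
  fixes F :: "('i \<Rightarrow> 'a) \<Rightarrow> real" and d :: "'i \<Rightarrow> real"
  assumes "finite J" "F \<in> borel_measurable (Pi\<^sub>M J M)"
    and "\<And>x. x \<in> space (Pi\<^sub>M J M) \<Longrightarrow> \<bar>F x\<bar> \<le> B"
    and "\<And>x i y. x \<in> space (Pi\<^sub>M J M) \<Longrightarrow> i \<in> J \<Longrightarrow> y \<in> space (M i) \<Longrightarrow> \<bar>F x - F (x(i := y))\<bar> \<le> d i"
  shows "(\<integral>\<^sup>+x. ennreal (exp (l * (F x - (\<integral>x. F x \<partial>Pi\<^sub>M J M)))) \<partial>Pi\<^sub>M J M)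
    \<le> ennreal (exp (l\<^sup>2 / 8 * (\<Sum>i\<in>J. (d i)\<^sup>2)))"
  using assms
proof (induction J arbitrary: F rule: finite_induct)
  case empty
  then show ?case by (simp add: PiM_empty nn_integral_count_space_finite lebesgue_integral_count_space_finite)
next
  case (insert i J)
  note [measurable] = insert.prems(1)
  interpret J: prob_space "Pi\<^sub>M J M" by (rule prob_space_PiM) (rule M.prob_space_axioms)
  interpret iI: prob_space "Pi\<^sub>M (insert i J) M" by (rule prob_space_PiM) (rule M.prob_space_axioms)
  have upd: "x(i := y) \<in> space (Pi\<^sub>M (insert i J) M)"
    if "x \<in> space (Pi\<^sub>M J M)" "y \<in> space (M i)" for x y
    using that by (auto simp: space_PiM PiE_iff extensional_def)
  have meas_pair: "(\<lambda>(x, y). F (x(i := y))) \<in> borel_measurable (Pi\<^sub>M J M \<Otimes>\<^sub>M M i)"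
    by measurable
  have meas: "(\<lambda>y. F (x(i := y))) \<in> borel_measurable (M i)" if "x \<in> space (Pi\<^sub>M J M)" for x
    by (rule measurable_compose[OF measurable_component_update[OF that insert.hyps(2)] insert.prems(1)])
  have int: "integrable (M i) (\<lambda>y. F (x(i := y)))" if x: "x \<in> space (Pi\<^sub>M J M)" for x
    using meas[OF x] insert.prems(2)[OF upd[OF x]] by (rule M.bounded_expectation)
  \<comment> \<open>The conditional mean of \<open>F\<close> given the coordinates in
    \<open>J\<close>. It inherits the bound and the oscillations of \<open>F\<close>, so the
    induction hypothesis applies to it.\<close>
  define G where "G x = (\<integral>y. F (x(i := y)) \<partial>M i)" for x
  have G_meas [measurable]: "G \<in> borel_measurable (Pi\<^sub>M J M)"
    using meas_pair unfolding G_def by measurable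
  have G_bound: "\<bar>G x\<bar> \<le> B" if x: "x \<in> space (Pi\<^sub>M J M)" for x
    unfolding G_def using meas[OF x] insert.prems(2)[OF upd[OF x]] by (rule M.bounded_expectation)
  have G_osc: "\<bar>G x - G (x(j := y))\<bar> \<le> d j"
    if x: "x \<in> space (Pi\<^sub>M J M)" and j: "j \<in> J" and y: "y \<in> space (M j)" for x j y
  proof -
    have x': "x(j := y) \<in> space (Pi\<^sub>M J M)"
      using x j y by (auto simp: space_PiM PiE_iff extensional_def)
    have "j \<noteq> i" using j insert.hyps by auto
    have "G x - G (x(j := y)) = (\<integral>z. F (x(i := z)) - F ((x(j := y))(i := z)) \<partial>M i)"
      unfolding G_def by (intro Bochner_Integration.integral_diff[symmetric] int x x')
    moreover have "\<bar>F (x(i := z)) - F ((x(j := y))(i := z))\<bar> \<le> d j" if "z \<in> space (M i)" for z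
      unfolding fun_upd_twist[OF \<open>j \<noteq> i\<close>]
      by (rule insert.prems(3)[OF upd[OF x that] _ y]) (use j in simp)
    then have "\<bar>\<integral>z. F (x(i := z)) - F ((x(j := y))(i := z)) \<partial>M i\<bar> \<le> d j"
      by (intro M.bounded_expectation borel_measurable_diff meas x x')
    ultimately show ?thesis by simp
  qed
  have "integrable (Pi\<^sub>M (insert i J) M) F"
    using insert.prems(1,2) by (rule iI.bounded_expectation)
  then have mean: "(\<integral>x. F x \<partial>Pi\<^sub>M (insert i J) M) = (\<integral>x. G x \<partial>Pi\<^sub>M J M)" (is "?m = _")
    unfolding G_def by (rule product_integral_insert[OF insert.hyps])
  \<comment> \<open>Split \<open>F - ?m\<close> into \<open>F - G\<close> and \<open>G - ?m\<close>:
    the first is centred in coordinate \<open>i\<close> and falls to Hoeffding, the second is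
    constant in that coordinate and leaves the integral.\<close>
  have inner: "(\<integral>\<^sup>+y. ennreal (exp (l * (F (x(i := y)) - ?m))) \<partial>M i)
      \<le> ennreal (exp (l\<^sup>2 / 8 * (d i)\<^sup>2)) * ennreal (exp (l * (G x - ?m)))"
    if x: "x \<in> space (Pi\<^sub>M J M)" for x
  proof -
    note [measurable] = meas[OF x]
    have "F (x(i := y)) - F (x(i := y')) \<le> d i" if "y \<in> space (M i)" "y' \<in> space (M i)" for y y'
      using insert.prems(3)[OF upd[OF x that(1)] _ that(2)] by (simp add: abs_le_iff del: fun_upd_apply)
    then have "(\<integral>\<^sup>+y. ennreal (exp (l * (F (x(i := y)) - G x))) \<partial>M i) \<le> ennreal (exp (l\<^sup>2 * (d i)\<^sup>2 / 8))"
      unfolding G_def by (intro M.Hoeffding_exp_bound) auto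
    moreover have "(\<integral>\<^sup>+y. ennreal (exp (l * (F (x(i := y)) - ?m))) \<partial>M i)
      = (\<integral>\<^sup>+y. ennreal (exp (l * (F (x(i := y)) - G x))) \<partial>M i) * ennreal (exp (l * (G x - ?m)))"
      by (subst nn_integral_multc[symmetric])
         (auto intro!: nn_integral_cong simp: algebra_simps simp flip: ennreal_mult exp_add)
    ultimately show ?thesis by (auto intro: mult_right_mono)
  qed
  have "(\<integral>\<^sup>+x. ennreal (exp (l * (F x - ?m))) \<partial>Pi\<^sub>M (insert i J) M)
    = (\<integral>\<^sup>+x. \<integral>\<^sup>+y. ennreal (exp (l * (F (x(i := y)) - ?m))) \<partial>M i \<partial>Pi\<^sub>M J M)"
    by (rule product_nn_integral_insert[OF insert.hyps]) measurable
  also have "\<dots> \<le> (\<integral>\<^sup>+x. ennreal (exp (l\<^sup>2 / 8 * (d i)\<^sup>2)) * ennreal (exp (l * (G x - ?m))) \<partial>Pi\<^sub>M J M)"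
    by (intro nn_integral_mono inner)
  also have "\<dots> = ennreal (exp (l\<^sup>2 / 8 * (d i)\<^sup>2)) * (\<integral>\<^sup>+x. ennreal (exp (l * (G x - ?m))) \<partial>Pi\<^sub>M J M)"
    by (rule nn_integral_cmult) measurable
  also have "\<dots> \<le> ennreal (exp (l\<^sup>2 / 8 * (d i)\<^sup>2)) * ennreal (exp (l\<^sup>2 / 8 * (\<Sum>i\<in>J. (d i)\<^sup>2)))"
    unfolding mean by (intro mult_left_mono insert.IH G_meas G_bound G_osc) auto
  also have "\<dots> = ennreal (exp (l\<^sup>2 / 8 * (\<Sum>i\<in>insert i J. (d i)\<^sup>2)))"
    using insert.hyps by (simp add: distrib_left exp_add flip: ennreal_mult)
  finally show ?case .
qed

text \<open>Doeblin's minorisation: the stationary density is \<open>\<Sum>n. \<phi> n\<close>, where \<open>\<phi> 0 = \<epsilon>\<close> is the mass of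
  the chain regenerated now and \<open>\<phi> n\<close> that of the chain regenerated \<open>n\<close> steps ago. Any stationary
  density dominates the partial sums, and all of them have mass 1.\<close>

lemma (in prob_space) Doeblin_fixed_point:
  fixes k :: "'a \<Rightarrow> 'a \<Rightarrow> ennreal" and \<epsilon> :: real
  assumes k [measurable]: "(\<lambda>(u, x). k u x) \<in> borel_measurable (M \<Otimes>\<^sub>M M)"
    and "0 < \<epsilon>" and k_ge: "\<And>u x. u \<in> space M \<Longrightarrow> x \<in> space M \<Longrightarrow> ennreal \<epsilon> \<le> k u x"
    and k_mass: "\<And>u. u \<in> space M \<Longrightarrow> (\<integral>\<^sup>+x. k u x \<partial>M) = 1"
  shows "\<exists>\<rho>. sets \<rho> = sets M \<and> prob_space \<rho> \<and> density M (\<lambda>x. \<integral>\<^sup>+u. k u x \<partial>\<rho>) = \<rho> \<and>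
    (\<forall>\<rho>'. sets \<rho>' = sets M \<longrightarrow> prob_space \<rho>' \<longrightarrow> density M (\<lambda>x. \<integral>\<^sup>+u. k u x \<partial>\<rho>') = \<rho>' \<longrightarrow> \<rho>' = \<rho>)"
proof -
  \<comment> \<open>The residual kernel after regeneration. Truncated subtraction does no harm
    because \<open>k\<close> dominates the constant.\<close>
  define r where "r u x = k u x - ennreal \<epsilon>" for u x
  have r [measurable]: "(\<lambda>(u, x). r u x) \<in> borel_measurable (M \<Otimes>\<^sub>M M)"
    unfolding r_def by measurable
  have k_eq: "k u x = ennreal \<epsilon> + r u x" if "u \<in> space M" "x \<in> space M" for u x
    unfolding r_def using k_ge[OF that] by (simp add: add_diff_inverse_ennreal)
  have r_mass: "(\<integral>\<^sup>+x. r u x \<partial>M) = 1 - ennreal \<epsilon>" if u: "u \<in> space M" for u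
    unfolding r_def using k_ge[OF u] k_mass[OF u] emeasure_space_1 u
    by (subst nn_integral_diff) (auto intro!: AE_I2)
  obtain u0 where "u0 \<in> space M" using not_empty by blast
  then have "(\<integral>\<^sup>+x. ennreal \<epsilon> \<partial>M) \<le> 1"
    unfolding k_mass[OF \<open>u0 \<in> space M\<close>, symmetric] by (intro nn_integral_mono k_ge)
  then have "\<epsilon> \<le> 1" using emeasure_space_1 by simp
  define \<phi> where "\<phi> n = ((\<lambda>\<phi> x. \<integral>\<^sup>+u. r u x * \<phi> u \<partial>M) ^^ n) (\<lambda>_. ennreal \<epsilon>)" for n
  have \<phi>_0: "\<phi> 0 = (\<lambda>_. ennreal \<epsilon>)" and \<phi>_Suc: "\<phi> (Suc n) = (\<lambda>x. \<integral>\<^sup>+u. r u x * \<phi> n u \<partial>M)" for n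
    by (simp_all add: \<phi>_def)
  have \<phi>_meas [measurable]: "\<phi> n \<in> borel_measurable M" for n
    by (induction n) (simp_all add: \<phi>_0 \<phi>_Suc)
  have \<phi>_mass: "(\<integral>\<^sup>+x. \<phi> n x \<partial>M) = ennreal (\<epsilon> * (1 - \<epsilon>) ^ n)" for n
  proof (induction n)
    case 0
    then show ?case using emeasure_space_1 by (simp add: \<phi>_0)
  next
    case (Suc n)
    interpret pair_sigma_finite M M by unfold_locales
    have "(\<integral>\<^sup>+x. \<phi> (Suc n) x \<partial>M) = (\<integral>\<^sup>+u. \<integral>\<^sup>+x. r u x * \<phi> n u \<partial>M \<partial>M)"
      unfolding \<phi>_Suc by (rule Fubini') measurable
    also have "\<dots> = (\<integral>\<^sup>+u. ennreal (1 - \<epsilon>) * \<phi> n u \<partial>M)"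
      using \<open>0 < \<epsilon>\<close> by (intro nn_integral_cong) (simp add: nn_integral_multc r_mass ennreal_minus flip: ennreal_1)
    also have "\<dots> = ennreal (1 - \<epsilon>) * ennreal (\<epsilon> * (1 - \<epsilon>) ^ n)"
      by (simp add: nn_integral_cmult Suc)
    finally show ?case using \<open>0 < \<epsilon>\<close> \<open>\<epsilon> \<le> 1\<close> by (simp add: mult_ac flip: ennreal_mult)
  qed
  define \<Phi> where "\<Phi> x = (\<Sum>n. \<phi> n x)" for x
  have [measurable]: "\<Phi> \<in> borel_measurable M" unfolding \<Phi>_def by measurable
  have "(\<lambda>n. \<epsilon> * (1 - \<epsilon>) ^ n) sums (\<epsilon> * (1 / (1 - (1 - \<epsilon>))))"
    using \<open>0 < \<epsilon>\<close> \<open>\<epsilon> \<le> 1\<close> by (intro sums_mult geometric_sums) simp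
  then have sums: "(\<lambda>n. \<epsilon> * (1 - \<epsilon>) ^ n) sums 1" using \<open>0 < \<epsilon>\<close> by simp
  have \<Phi>_mass: "(\<integral>\<^sup>+x. \<Phi> x \<partial>M) = 1"
    unfolding \<Phi>_def using sums \<open>0 < \<epsilon>\<close> \<open>\<epsilon> \<le> 1\<close>
    by (simp add: nn_integral_suminf \<phi>_mass suminf_ennreal2 sums_iff)
  \<comment> \<open>For a density of mass 1 the regenerating part contributes exactly the constant
    \<open>\<epsilon>\<close>, whatever the density.\<close>
  have step: "(\<integral>\<^sup>+u. k u x * \<psi> u \<partial>M) = ennreal \<epsilon> + (\<integral>\<^sup>+u. r u x * \<psi> u \<partial>M)"
    if [measurable]: "\<psi> \<in> borel_measurable M" and "(\<integral>\<^sup>+x. \<psi> x \<partial>M) = 1" and x [measurable]: "x \<in> space M" for \<psi> x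
  proof -
    have "(\<integral>\<^sup>+u. k u x * \<psi> u \<partial>M) = (\<integral>\<^sup>+u. ennreal \<epsilon> * \<psi> u + r u x * \<psi> u \<partial>M)"
      by (intro nn_integral_cong) (simp add: k_eq x distrib_right)
    then show ?thesis by (simp add: nn_integral_add nn_integral_cmult that)
  qed
  have dens: "(\<integral>\<^sup>+u. k u x \<partial>density M \<psi>) = (\<integral>\<^sup>+u. k u x * \<psi> u \<partial>M)"
    if [measurable]: "\<psi> \<in> borel_measurable M" "x \<in> space M" for \<psi> x
    by (subst nn_integral_density) (auto simp: mult.commute)
  define \<rho> where "\<rho> = density M \<Phi>"
  have "sets \<rho> = sets M" by (simp add: \<rho>_def)
  moreover have prob_\<rho>: "prob_space \<rho>"
    by (rule prob_spaceI) (simp add: \<rho>_def emeasure_density \<Phi>_mass cong: nn_integral_cong)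
  moreover have "density M (\<lambda>x. \<integral>\<^sup>+u. k u x \<partial>\<rho>) = \<rho>"
    unfolding \<rho>_def
  proof (intro density_cong AE_I2)
    interpret \<rho>: prob_space "density M \<Phi>" using prob_\<rho> by (simp add: \<rho>_def)
    show "(\<lambda>x. \<integral>\<^sup>+u. k u x \<partial>density M \<Phi>) \<in> borel_measurable M" by measurable
    fix x assume x [measurable]: "x \<in> space M"
    have "(\<integral>\<^sup>+u. k u x \<partial>density M \<Phi>) = ennreal \<epsilon> + (\<integral>\<^sup>+u. r u x * \<Phi> u \<partial>M)"
      by (simp add: dens step \<Phi>_mass x)
    also have "(\<integral>\<^sup>+u. r u x * \<Phi> u \<partial>M) = (\<Sum>n. \<integral>\<^sup>+u. r u x * \<phi> n u \<partial>M)"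
      unfolding \<Phi>_def by (simp add: nn_integral_suminf flip: ennreal_suminf_cmult)
    also have "\<dots> = (\<Sum>n. \<phi> (Suc n) x)" by (simp add: \<phi>_Suc)
    also have "ennreal \<epsilon> + (\<Sum>n. \<phi> (Suc n) x) = \<Phi> x"
      unfolding \<Phi>_def by (subst suminf_offset[where f = "\<lambda>n. \<phi> n x" and i = 1]) (simp_all add: \<phi>_0)
    finally show "(\<integral>\<^sup>+u. k u x \<partial>density M \<Phi>) = \<Phi> x" .
  qed simp
  moreover have "\<rho>' = \<rho>"
    if sets': "sets \<rho>' = sets M" and "prob_space \<rho>'" and stationary: "density M (\<lambda>x. \<integral>\<^sup>+u. k u x \<partial>\<rho>') = \<rho>'" for \<rho>'
  proof -
    interpret \<rho>': prob_space \<rho>' by fact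
    interpret \<rho>: prob_space \<rho> by fact
    note [measurable_cong] = sets'
    define \<psi> where "\<psi> x = (\<integral>\<^sup>+u. k u x \<partial>\<rho>')" for x
    have [measurable]: "\<psi> \<in> borel_measurable M" unfolding \<psi>_def by measurable
    have \<rho>'_eq: "\<rho>' = density M \<psi>" unfolding \<psi>_def stationary ..
    have "(\<integral>\<^sup>+x. \<psi> x \<partial>M) = emeasure \<rho>' (space \<rho>')"
      by (simp add: \<rho>'_eq emeasure_density cong: nn_integral_cong)
    then have \<psi>_mass: "(\<integral>\<^sup>+x. \<psi> x \<partial>M) = 1" using \<rho>'.emeasure_space_1 by simp
    have \<psi>_eq: "\<psi> x = ennreal \<epsilon> + (\<integral>\<^sup>+u. r u x * \<psi> u \<partial>M)" if x: "x \<in> space M" for x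
    proof -
      have "\<psi> x = (\<integral>\<^sup>+u. k u x \<partial>density M \<psi>)" by (simp add: \<psi>_def flip: \<rho>'_eq)
      then show ?thesis by (simp add: dens step \<psi>_mass x)
    qed
    \<comment> \<open>Splitting off the term for 0 exhibits the next partial sum as
      \<open>\<epsilon>\<close> plus the residual kernel applied to the previous one;
      \<open>\<psi>\<close> solves the same equation, so monotonicity closes the induction.\<close>
    have partial: "(\<Sum>n<m. \<phi> n x) \<le> \<psi> x" if "x \<in> space M" for x m
      using that
    proof (induction m arbitrary: x)
      case (Suc m)
      note [measurable] = Suc.prems
      have "(\<Sum>n<Suc m. \<phi> n x) = ennreal \<epsilon> + (\<Sum>n<m. \<integral>\<^sup>+u. r u x * \<phi> n u \<partial>M)"
        unfolding sum.lessThan_Suc_shift by (simp add: \<phi>_0 \<phi>_Suc)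
      also have "\<dots> = ennreal \<epsilon> + (\<integral>\<^sup>+u. r u x * (\<Sum>n<m. \<phi> n u) \<partial>M)"
        by (simp add: sum_distrib_left nn_integral_sum)
      also have "\<dots> \<le> ennreal \<epsilon> + (\<integral>\<^sup>+u. r u x * \<psi> u \<partial>M)"
        by (intro add_left_mono nn_integral_mono mult_left_mono Suc.IH) auto
      finally show ?case by (simp add: \<psi>_eq Suc.prems)
    qed simp
    have le: "\<Phi> x \<le> \<psi> x" if "x \<in> space M" for x
      unfolding \<Phi>_def suminf_eq_SUP by (intro SUP_least partial that)
    have emeasure_le: "emeasure \<rho> A \<le> emeasure \<rho>' A" if [measurable]: "A \<in> sets M" for A
      by (simp add: \<rho>_def \<rho>'_eq emeasure_density) (intro nn_integral_mono mult_right_mono le; simp)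
    have measure_le: "measure \<rho> A \<le> measure \<rho>' A" if "A \<in> sets M" for A
      using emeasure_le[OF that] by (simp add: \<rho>.emeasure_eq_measure \<rho>'.emeasure_eq_measure)
    have sp: "space \<rho> = space M" "space \<rho>' = space M" "sets \<rho> = sets M"
      using sets' sets_eq_imp_space_eq by (auto simp: \<rho>_def)
    show ?thesis
    proof (rule measure_eqI)
      fix A assume "A \<in> sets \<rho>'"
      then have A: "A \<in> sets M" using sets' by simp
      \<comment> \<open>Two probability measures with one below the other coincide: the inequality
        on the complement is the reverse inequality on \<open>A\<close>.\<close>
      have "1 - measure \<rho> A \<le> 1 - measure \<rho>' A"
        using measure_le[of "space M - A"] \<rho>.prob_compl[of A] \<rho>'.prob_compl[of A] A sp sets' by simp
      then have "measure \<rho> A = measure \<rho>' A" using measure_le[OF A] by simp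
      then show "emeasure \<rho>' A = emeasure \<rho> A"
        by (simp add: \<rho>.emeasure_eq_measure \<rho>'.emeasure_eq_measure)
    qed (simp add: sets' \<rho>_def)
  qed
  ultimately show ?thesis by blast
qed

section \<open>The noise\<close>

text \<open>The half-open interval meets each class modulo 1 once. The mass of \<open>q\<close> is
  left free, since the uniform part \<open>1\<close> and the excess \<open>p - c\<close> of the
  noise are used alongside \<open>p\<close>.\<close>

definition unit_density :: "(real \<Rightarrow> real) \<Rightarrow> real measure" where
  "unit_density q = density lborel (\<lambda>x. ennreal (q x * indicator {0..<1} x))"

lemma sets_unit_density [measurable_cong, simp]: "sets (unit_density q) = sets borel"
  by (simp add: unit_density_def)

lemma space_unit_density [simp]: "space (unit_density q) = UNIV"
  by (simp add: unit_density_def)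

lemma nn_integral_unit_density:
  assumes [measurable]: "q \<in> borel_measurable borel" "G \<in> borel_measurable borel"
  shows "(\<integral>\<^sup>+x. G x \<partial>unit_density q) = (\<integral>\<^sup>+x\<in>{0..<1}. ennreal (q x) * G x \<partial>lborel)"
  unfolding unit_density_def
  by (subst nn_integral_density) (auto intro!: nn_integral_cong simp: indicator_def)

text \<open>After substituting \<open>x\<close> for \<open>w + s\<close> the integrand is periodic,
  so the window of integration can be moved back to \<open>[0,1)\<close> and the shift ends up in
  the density.\<close>

lemma distr_unit_density_shift:
  assumes [measurable]: "q \<in> borel_measurable borel" and per: "\<And>x k. q (x + of_int k) = q x"
  shows "distr (unit_density q) borel (\<lambda>w. to_circle (w + s))
    = density circle_lebesgue (\<lambda>x. ennreal (q (circle_rep x - s)))"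
proof (rule measure_eqI)
  fix A assume "A \<in> sets (distr (unit_density q) borel (\<lambda>w. to_circle (w + s)))"
  then have [measurable]: "A \<in> sets borel" by simp
  have q_frac: "q (frac x - s) = q (x - s)" for x
    using per[of "x - s" "- \<lfloor>x\<rfloor>"] by (simp add: frac_def algebra_simps)
  let ?F = "\<lambda>x. ennreal (q (x - s)) * indicator A (to_circle x)"
  have F_per: "?F (x + of_int k) = ?F x" for x k
    using per[of "x - s" k] by (simp add: to_circle_add_int algebra_simps)
  have "emeasure (distr (unit_density q) borel (\<lambda>w. to_circle (w + s))) A
    = (\<integral>\<^sup>+w. indicator A (to_circle (w + s)) \<partial>unit_density q)"
    using nn_integral_distr[of "\<lambda>w. to_circle (w + s)" "unit_density q" borel "indicator A"] by simp
  also have "\<dots> = (\<integral>\<^sup>+w\<in>{0..<1}. ?F (w + s) \<partial>lborel)"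
    by (subst nn_integral_unit_density) simp_all
  also have "\<dots> = (\<integral>\<^sup>+w\<in>{0..<1}. ?F w \<partial>lborel)"
    by (rule nn_integral_periodic_shift[OF _ F_per]) measurable
  also have "\<dots> = (\<integral>\<^sup>+x. ennreal (q (circle_rep x - s)) * indicator A x \<partial>circle_lebesgue)"
    by (subst nn_integral_circle_lebesgue) (simp_all add: circle_rep_to_circle q_frac)
  also have "\<dots> = emeasure (density circle_lebesgue (\<lambda>x. ennreal (q (circle_rep x - s)))) A"
    by (simp add: emeasure_density)
  finally show "emeasure (distr (unit_density q) borel (\<lambda>w. to_circle (w + s))) A
    = emeasure (density circle_lebesgue (\<lambda>x. ennreal (q (circle_rep x - s)))) A" .
qed (simp add: sets_circle_lebesgue)

lemma integral_unit_density_1_shift: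
  fixes g :: "circle \<Rightarrow> real"
  assumes [measurable]: "g \<in> borel_measurable borel"
  shows "(\<integral>w. g (to_circle (w + s)) \<partial>unit_density (\<lambda>_. 1)) = (\<integral>x. g x \<partial>circle_lebesgue)"
proof -
  have "(\<integral>w. g (to_circle (w + s)) \<partial>unit_density (\<lambda>_. 1))
    = (\<integral>x. g x \<partial>distr (unit_density (\<lambda>_. 1)) borel (\<lambda>w. to_circle (w + s)))"
    by (subst integral_distr) simp_all
  also have "distr (unit_density (\<lambda>_. 1)) borel (\<lambda>w. to_circle (w + s)) = density circle_lebesgue (\<lambda>_. 1)"
    by (subst distr_unit_density_shift) simp_all
  finally show ?thesis by (simp add: density_1)
qed

locale noise =
  fixes p :: "real \<Rightarrow> real" and c :: real
  assumes p_measurable [measurable]: "p \<in> borel_measurable borel"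
    and p_periodic: "p (x + 1) = p x"
    and p_mass: "(\<integral>\<^sup>+x\<in>{0..1}. ennreal (p x) \<partial>lborel) = 1"
    and c_pos: "0 < c"
    and p_greater: "x \<in> {0..1} \<Longrightarrow> c < p x"
begin

lemma p_add_int: "p (x + of_int k) = p x"
proof (induction k rule: int_induct[where k = 0])
  case (step1 i)
  then show ?case using p_periodic[of "x + of_int i"] by (simp add: algebra_simps)
next
  case (step2 i)
  then show ?case using p_periodic[of "x + of_int (i - 1)"] by (simp add: algebra_simps)
qed simp

lemma c_less_p: "c < p x"
proof -
  have "p x = p (frac x)" using p_add_int[of x "- \<lfloor>x\<rfloor>"] by (simp add: frac_def)
  then show ?thesis using p_greater[of "frac x"] frac_lt_1[of x] by simp
qed

lemma p_nonneg: "0 \<le> p x"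
  using c_less_p[of x] c_pos by simp

lemma p_mass_half_open: "(\<integral>\<^sup>+x\<in>{0..<1}. ennreal (p x) \<partial>lborel) = 1"
proof -
  have "(\<integral>\<^sup>+x\<in>{0..<1}. ennreal (p x) \<partial>lborel) = (\<integral>\<^sup>+x\<in>{0..1}. ennreal (p x) \<partial>lborel)"
    by (intro nn_integral_cong_AE eventually_mono[OF AE_lborel_singleton[of 1]])
       (auto simp: indicator_def)
  then show ?thesis by (simp add: p_mass)
qed

abbreviation "\<omega> \<equiv> unit_density p"

lemma prob_space_noise: "prob_space \<omega>"
proof
  have "emeasure \<omega> (space \<omega>) = (\<integral>\<^sup>+x. 1 \<partial>\<omega>)" by simp
  also have "\<dots> = 1" by (subst nn_integral_unit_density) (simp_all add: p_mass_half_open)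
  finally show "emeasure \<omega> (space \<omega>) = 1" .
qed

text \<open>Integrating \<open>p = (p - c) + c\<close> over \<open>[0,1)\<close> gives 1 as the sum
  of the excess mass and \<open>c\<close>; both claims are read off from this identity.\<close>

lemma emeasure_excess: "emeasure (unit_density (\<lambda>x. p x - c)) UNIV = ennreal (1 - c)"
  and c_le_1: "c \<le> 1"
proof -
  have e: "emeasure (unit_density (\<lambda>x. p x - c)) UNIV = (\<integral>\<^sup>+x\<in>{0..<1}. ennreal (p x - c) \<partial>lborel)"
    using nn_integral_unit_density[of "\<lambda>x. p x - c" "\<lambda>_. 1"] by simp
  have "1 = (\<integral>\<^sup>+x. ennreal (p x - c) * indicator {0..<1} x + ennreal c * indicator {0..<1} x \<partial>lborel)"
    unfolding p_mass_half_open[symmetric] using c_pos c_less_p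
    by (intro nn_integral_cong) (auto simp: indicator_def less_imp_le simp flip: ennreal_plus)
  also have "\<dots> = emeasure (unit_density (\<lambda>x. p x - c)) UNIV + ennreal c"
    unfolding e by (subst nn_integral_add) (simp_all add: nn_integral_cmult_indicator)
  finally have *: "emeasure (unit_density (\<lambda>x. p x - c)) UNIV + ennreal c = 1" ..
  then have "ennreal c \<le> 1" by (metis le_iff_add add.commute)
  then show "c \<le> 1" by simp
  from * have "emeasure (unit_density (\<lambda>x. p x - c)) UNIV = 1 - ennreal c"
    by (metis ennreal_add_diff_cancel_right ennreal_neq_top)
  then show "emeasure (unit_density (\<lambda>x. p x - c)) UNIV = ennreal (1 - c)"
    using c_pos by (simp add: ennreal_minus flip: ennreal_1)
qed

text \<open>The noise law is a uniform part of mass \<open>c\<close> plus the excess, whose density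
  is nonnegative as \<open>p > c\<close>. The bound on \<open>\<phi>\<close> makes it integrable
  against both finite measures.\<close>

lemma integral_noise_decomposition:
  fixes \<phi> :: "real \<Rightarrow> real"
  assumes [measurable]: "\<phi> \<in> borel_measurable borel" and bd: "\<And>x. \<bar>\<phi> x\<bar> \<le> B"
  shows "(\<integral>x. \<phi> x \<partial>\<omega>) = c * (\<integral>x. \<phi> x \<partial>unit_density (\<lambda>_. 1)) + (\<integral>x. \<phi> x \<partial>unit_density (\<lambda>x. p x - c))"
    and "integrable (unit_density (\<lambda>x. p x - c)) \<phi>"
proof -
  have fin: "finite_measure (unit_density (\<lambda>x. p x - c))"
    by (rule finite_measureI) (simp add: emeasure_excess)
  show int: "integrable (unit_density (\<lambda>x. p x - c)) \<phi>"
    by (rule finite_measure.integrable_const_bound[OF fin, where B = B]) (use bd in auto)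
  have "prob_space (unit_density (\<lambda>_. 1))"
    using nn_integral_unit_density[of "\<lambda>_. 1" "\<lambda>_. 1"] by (intro prob_spaceI) simp
  then have int1: "integrable (unit_density (\<lambda>_. 1)) \<phi>"
    by (intro finite_measure.integrable_const_bound[where B = B]) (use bd in \<open>auto simp: prob_space_def\<close>)
  have i: "integrable lborel (\<lambda>x. ((p x - c) * indicator {0..<1} x) * \<phi> x)"
    using int unfolding unit_density_def
    by (subst (asm) integrable_real_density) (auto simp: c_less_p less_imp_le)
  have i1: "integrable lborel (\<lambda>x. (1 * indicator {0..<1} x) * \<phi> x)"
    using int1 unfolding unit_density_def
    by (subst (asm) integrable_real_density) auto
  have "(\<integral>x. \<phi> x \<partial>\<omega>) = (\<integral>x. (p x * indicator {0..<1} x) * \<phi> x \<partial>lborel)"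
    unfolding unit_density_def by (rule integral_real_density) (auto simp: p_nonneg)
  also have "\<dots> = (\<integral>x. c * ((1 * indicator {0..<1} x) * \<phi> x) + ((p x - c) * indicator {0..<1} x) * \<phi> x \<partial>lborel)"
    by (intro Bochner_Integration.integral_cong) (auto simp: algebra_simps)
  also have "\<dots> = c * (\<integral>x. (1 * indicator {0..<1} x) * \<phi> x \<partial>lborel)
      + (\<integral>x. ((p x - c) * indicator {0..<1} x) * \<phi> x \<partial>lborel)"
    using i i1 by (subst Bochner_Integration.integral_add) auto
  also have "(\<integral>x. (1 * indicator {0..<1} x) * \<phi> x \<partial>lborel) = (\<integral>x. \<phi> x \<partial>unit_density (\<lambda>_. 1))"
    unfolding unit_density_def by (rule integral_real_density[symmetric]) auto
  also have "(\<integral>x. ((p x - c) * indicator {0..<1} x) * \<phi> x \<partial>lborel) = (\<integral>x. \<phi> x \<partial>unit_density (\<lambda>x. p x - c))"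
    unfolding unit_density_def by (rule integral_real_density[symmetric]) (auto simp: c_less_p less_imp_le)
  finally show "(\<integral>x. \<phi> x \<partial>\<omega>) = c * (\<integral>x. \<phi> x \<partial>unit_density (\<lambda>_. 1)) + (\<integral>x. \<phi> x \<partial>unit_density (\<lambda>x. p x - c))" .
qed

text \<open>The uniform part of the noise, of mass \<open>c\<close>, forgets the shift.\<close>

lemma noise_contraction:
  fixes g :: "circle \<Rightarrow> real"
  assumes [measurable]: "g \<in> borel_measurable borel" and bd: "\<And>x. \<bar>g x\<bar> \<le> B"
    and lip: "\<And>x y. \<bar>g x - g y\<bar> \<le> L * dist x y"
  shows "\<bar>(\<integral>w. g (to_circle (w + s)) \<partial>\<omega>) - (\<integral>w. g (to_circle (w + t)) \<partial>\<omega>)\<bar> \<le> (1 - c) * L * \<bar>s - t\<bar>"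
proof -
  have L: "0 \<le> L" using nonneg_if_abs_le_mult_dist lip .
  let ?E = "unit_density (\<lambda>x. p x - c)"
  note dec = integral_noise_decomposition[of "\<lambda>w. g (to_circle (w + _))" B, OF _ bd]
  have "(\<integral>w. g (to_circle (w + s)) \<partial>\<omega>) - (\<integral>w. g (to_circle (w + t)) \<partial>\<omega>)
    = (\<integral>w. g (to_circle (w + s)) \<partial>?E) - (\<integral>w. g (to_circle (w + t)) \<partial>?E)"
    by (simp add: dec(1) integral_unit_density_1_shift)
  also have "\<dots> = (\<integral>w. g (to_circle (w + s)) - g (to_circle (w + t)) \<partial>?E)"
    by (rule Bochner_Integration.integral_diff[symmetric]) (simp_all add: dec(2))
  finally have eq: "(\<integral>w. g (to_circle (w + s)) \<partial>\<omega>) - (\<integral>w. g (to_circle (w + t)) \<partial>\<omega>)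
    = (\<integral>w. g (to_circle (w + s)) - g (to_circle (w + t)) \<partial>?E)" .
  have "\<bar>g (to_circle (w + s)) - g (to_circle (w + t))\<bar> \<le> L * \<bar>s - t\<bar>" for w
    using lip[of "to_circle (w + s)" "to_circle (w + t)"] dist_to_circle_le[of "w + s" "w + t"] L
    by (smt (verit) mult_left_mono)
  moreover have "finite_measure ?E"
    by (rule finite_measureI) (simp add: emeasure_excess)
  then have int: "integrable ?E (\<lambda>w. L * \<bar>s - t\<bar>)" by (simp add: finite_measure.integrable_const)
  ultimately have "\<bar>\<integral>w. g (to_circle (w + s)) - g (to_circle (w + t)) \<partial>?E\<bar> \<le> (\<integral>w. L * \<bar>s - t\<bar> \<partial>?E)"
    by (intro order.trans[OF integral_abs_bound] integral_mono Bochner_Integration.integrable_abs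
        Bochner_Integration.integrable_diff dec(2)) auto
  also have "\<dots> = (1 - c) * L * \<bar>s - t\<bar>"
    using c_le_1 by (simp add: measure_def emeasure_excess)
  finally show ?thesis unfolding eq .
qed

end

section \<open>Independent noise on the torus\<close>

text \<open>Checked on boxes: the indicator of a box factorises like the density, so the integral of
  the product is the product of the integrals.\<close>

lemma (in product_sigma_finite) PiM_density:
  assumes fin: "finite I" and [measurable]: "\<And>i. i \<in> I \<Longrightarrow> F i \<in> borel_measurable (M i)"
    and sf: "\<And>i. sigma_finite_measure (density (M i) (F i))"
  shows "density (Pi\<^sub>M I M) (\<lambda>x. \<Prod>i\<in>I. F i (x i)) = Pi\<^sub>M I (\<lambda>i. density (M i) (F i))"
proof (rule product_sigma_finite.PiM_eqI)
  show "product_sigma_finite (\<lambda>i. density (M i) (F i))"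
    using sf by (simp add: product_sigma_finite_def)
  show "sets (density (Pi\<^sub>M I M) (\<lambda>x. \<Prod>i\<in>I. F i (x i))) = sets (Pi\<^sub>M I (\<lambda>i. density (M i) (F i)))"
    by (simp cong: sets_PiM_cong)
  fix A assume A: "\<And>i. i \<in> I \<Longrightarrow> A i \<in> sets (density (M i) (F i))"
  then have [measurable]: "A i \<in> sets (M i)" if "i \<in> I" for i using that by simp
  have [measurable]: "Pi\<^sub>E I A \<in> sets (Pi\<^sub>M I M)" by (intro sets_PiM_I_finite fin) simp
  have "emeasure (density (Pi\<^sub>M I M) (\<lambda>x. \<Prod>i\<in>I. F i (x i))) (Pi\<^sub>E I A)
    = (\<integral>\<^sup>+x. (\<Prod>i\<in>I. F i (x i)) * indicator (Pi\<^sub>E I A) x \<partial>Pi\<^sub>M I M)"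
    by (rule emeasure_density) measurable
  also have "\<dots> = (\<integral>\<^sup>+x. (\<Prod>i\<in>I. F i (x i) * indicator (A i) (x i)) \<partial>Pi\<^sub>M I M)"
    by (intro nn_integral_cong)
       (auto simp: indicator_def space_PiM PiE_iff fin intro!: prod.cong prod_zero)
  also have "\<dots> = (\<Prod>i\<in>I. \<integral>\<^sup>+x. F i x * indicator (A i) x \<partial>M i)"
    by (rule product_nn_integral_prod[OF fin]) measurable
  also have "\<dots> = (\<Prod>i\<in>I. emeasure (density (M i) (F i)) (A i))"
    by (intro prod.cong refl emeasure_density[symmetric]) auto
  finally show "emeasure (density (Pi\<^sub>M I M) (\<lambda>x. \<Prod>i\<in>I. F i (x i))) (Pi\<^sub>E I A)
    = (\<Prod>i\<in>I. emeasure (density (M i) (F i)) (A i))" .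
qed fact

text \<open>Checked on boxes, whose preimages under a coordinatewise map are boxes again.\<close>

lemma (in product_prob_space) PiM_distr:
  assumes fin: "finite J" and [measurable]: "\<And>i. T i \<in> M i \<rightarrow>\<^sub>M N i"
  shows "distr (Pi\<^sub>M J M) (Pi\<^sub>M J N) (\<lambda>x. \<lambda>i\<in>J. T i (x i)) = Pi\<^sub>M J (\<lambda>i. distr (M i) (N i) (T i))"
proof (rule product_sigma_finite.PiM_eqI)
  have "prob_space (distr (M i) (N i) (T i))" for i
    by (intro M.prob_space_distr) simp
  then show "product_sigma_finite (\<lambda>i. distr (M i) (N i) (T i))"
    by (simp add: product_sigma_finite_def prob_space_imp_sigma_finite)
  show "sets (distr (Pi\<^sub>M J M) (Pi\<^sub>M J N) (\<lambda>x. \<lambda>i\<in>J. T i (x i))) = sets (Pi\<^sub>M J (\<lambda>i. distr (M i) (N i) (T i)))"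
    by (simp cong: sets_PiM_cong)
  fix A assume A: "\<And>i. i \<in> J \<Longrightarrow> A i \<in> sets (distr (M i) (N i) (T i))"
  then have [measurable]: "A i \<in> sets (N i)" if "i \<in> J" for i using that by simp
  have "emeasure (distr (Pi\<^sub>M J M) (Pi\<^sub>M J N) (\<lambda>x. \<lambda>i\<in>J. T i (x i))) (Pi\<^sub>E J A)
    = emeasure (Pi\<^sub>M J M) ((\<lambda>x. \<lambda>i\<in>J. T i (x i)) -` Pi\<^sub>E J A \<inter> space (Pi\<^sub>M J M))"
    by (rule emeasure_distr) (auto intro!: sets_PiM_I_finite fin)
  also have "(\<lambda>x. \<lambda>i\<in>J. T i (x i)) -` Pi\<^sub>E J A \<inter> space (Pi\<^sub>M J M) = (\<Pi>\<^sub>E i\<in>J. T i -` A i \<inter> space (M i))"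
    by (auto simp: space_PiM PiE_iff)
  also have "emeasure (Pi\<^sub>M J M) \<dots> = (\<Prod>i\<in>J. emeasure (M i) (T i -` A i \<inter> space (M i)))"
    by (rule emeasure_PiM[OF fin]) (auto intro!: measurable_sets)
  also have "\<dots> = (\<Prod>i\<in>J. emeasure (distr (M i) (N i) (T i)) (A i))"
    by (intro prod.cong refl emeasure_distr[symmetric]) auto
  finally show "emeasure (distr (Pi\<^sub>M J M) (Pi\<^sub>M J N) (\<lambda>x. \<lambda>i\<in>J. T i (x i))) (Pi\<^sub>E J A)
    = (\<Prod>i\<in>J. emeasure (distr (M i) (N i) (T i)) (A i))" .
qed fact

text \<open>The shift \<open>y\<close> is kept real-valued, so that its differences enter the
  Lipschitz estimates without reduction modulo 1.\<close>

definition perturb :: "('n \<Rightarrow> real) \<Rightarrow> ('n \<Rightarrow> real) \<Rightarrow> circle ^ 'n" where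
  "perturb y w = (\<chi> j. to_circle (w j + y j))"

lemma perturb_nth [simp]: "perturb y w $ j = to_circle (w j + y j)"
  by (simp add: perturb_def)

context noise
begin

lemma product_prob_space_noise: "product_prob_space (\<lambda>_. \<omega>)"
  by (intro product_prob_spaceI prob_space_noise)

abbreviation \<Omega> :: "('n::finite \<Rightarrow> real) measure" where
  "\<Omega> \<equiv> Pi\<^sub>M UNIV (\<lambda>_. \<omega>)"

lemma prob_space_\<Omega>: "prob_space (\<Omega> :: ('n::finite \<Rightarrow> real) measure)"
  by (rule prob_space_PiM) (rule prob_space_noise)

lemma perturb_measurable [measurable]: "perturb y \<in> (\<Omega> :: ('n::finite \<Rightarrow> real) measure) \<rightarrow>\<^sub>M borel"
  unfolding perturb_def by measurable

text \<open>Connects additive noise with the density form of the transfer operator: one coordinate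
  is \<open>distr_unit_density_shift\<close>, and independence lets densities and image measures
  pass through the product.\<close>

lemma perturb_law:
  fixes y :: "'n::finite \<Rightarrow> real"
  shows "distr \<Omega> borel (perturb y)
    = density torus_lebesgue (\<lambda>x. \<Prod>j\<in>UNIV. ennreal (p (circle_rep (x $ j) - y j)))"
proof -
  interpret \<omega>: product_prob_space "\<lambda>_::'n. \<omega>" by (rule product_prob_space_noise)
  interpret CL: product_prob_space "\<lambda>_::'n. circle_lebesgue"
    by (intro product_prob_spaceI prob_space_circle_lebesgue)
  let ?C = "\<Pi>\<^sub>M j\<in>(UNIV::'n set). circle_lebesgue" and ?vec = "\<lambda>x. \<chi> i. x i"
  let ?\<nu> = "\<lambda>j. density circle_lebesgue (\<lambda>x. ennreal (p (circle_rep x - y j)))"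
  have \<nu>_eq: "distr \<omega> borel (\<lambda>w. to_circle (w + y j)) = ?\<nu> j" for j
    by (rule distr_unit_density_shift) (simp_all add: p_add_int)
  have \<nu>_prob: "prob_space (?\<nu> j)" for j
    unfolding \<nu>_eq[symmetric] by (rule prob_space.prob_space_distr[OF prob_space_noise]) simp
  have "density torus_lebesgue (\<lambda>x. \<Prod>j\<in>UNIV. ennreal (p (circle_rep (x $ j) - y j)))
    = distr (density ?C (\<lambda>x. \<Prod>j\<in>UNIV. ennreal (p (circle_rep (x j) - y j)))) borel ?vec"
    unfolding torus_lebesgue_def by (subst density_distr) (simp_all add: torus_map_measurable)
  also have "density ?C (\<lambda>x. \<Prod>j\<in>UNIV. ennreal (p (circle_rep (x j) - y j))) = Pi\<^sub>M UNIV ?\<nu>"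
    by (rule CL.PiM_density) (auto intro: prob_space_imp_sigma_finite \<nu>_prob)
  also have "\<dots> = distr \<Omega> (Pi\<^sub>M UNIV (\<lambda>_. borel)) (\<lambda>w. \<lambda>j\<in>UNIV. to_circle (w j + y j))"
    unfolding \<nu>_eq[symmetric]
    using \<omega>.PiM_distr[of UNIV "\<lambda>j w. to_circle (w + y j)" "\<lambda>_. borel"] by simp
  also have "distr \<dots> borel ?vec = distr \<Omega> borel (perturb y)"
    by (subst distr_distr) (auto simp: perturb_def comp_def intro!: distr_cong ext)
  finally show ?thesis ..
qed

lemma integrable_perturb:
  fixes g :: "circle ^ 'n::finite \<Rightarrow> real"
  assumes "is_lipschitz g"
  shows "integrable \<Omega> (\<lambda>w. g (perturb y w))"
proof -
  note [measurable] = is_lipschitz_measurable[OF assms]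
  show ?thesis
    by (rule prob_space.bounded_expectation(1)[OF prob_space_\<Omega> _ lipschitz_abs_le[OF assms]]) measurable
qed

text \<open>By telescoping it suffices to change one coordinate of the shift. Fubini puts the noise
  of that coordinate innermost, where the one-dimensional contraction applies with the others
  frozen.\<close>

lemma perturb_contraction:
  fixes g :: "circle ^ 'n::finite \<Rightarrow> real"
  assumes g: "is_lipschitz g"
  shows "\<bar>(\<integral>w. g (perturb y w) \<partial>\<Omega>) - (\<integral>w. g (perturb y' w) \<partial>\<Omega>)\<bar>
    \<le> (\<Sum>j\<in>UNIV. (1 - c) * Lip_coord j g * \<bar>y j - y' j\<bar>)"
proof (rule telescope_coordinates[where G = "\<lambda>y. \<integral>w. g (perturb y w) \<partial>\<Omega>"])
  fix i :: 'n and y :: "'n \<Rightarrow> real" and a :: real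
  note [measurable] = is_lipschitz_measurable[OF g]
  let ?I = "UNIV - {i}" and ?B = "\<bar>g undefined\<bar> + Lip_sum g"
  let ?K = "(1 - c) * Lip_coord i g * \<bar>y i - a\<bar>"
  interpret \<omega>: product_prob_space "\<lambda>_::'n. \<omega>" by (rule product_prob_space_noise)
  interpret R: prob_space "Pi\<^sub>M ?I (\<lambda>_. \<omega>)" by (rule prob_space_PiM) (rule prob_space_noise)
  have ins: "insert i ?I = UNIV" by auto
  \<comment> \<open>The mean over the noise of coordinate \<open>i\<close> alone, the remaining
    noise being frozen at \<open>x\<close>.\<close>
  define A where "A z x = (\<integral>v. g (perturb z (x(i := v))) \<partial>\<omega>)" for z x
  have meas_pair: "(\<lambda>(x, v). g (perturb z (x(i := v)))) \<in> borel_measurable (Pi\<^sub>M ?I (\<lambda>_. \<omega>) \<Otimes>\<^sub>M \<omega>)" for z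
  proof -
    have "(\<lambda>w. g (perturb z w)) \<in> borel_measurable (Pi\<^sub>M (insert i ?I) (\<lambda>_. \<omega>))"
      unfolding ins by measurable
    from measurable_compose[OF measurable_add_dim this] show ?thesis by (simp add: case_prod_beta')
  qed
  then have A_meas [measurable]: "A z \<in> borel_measurable (Pi\<^sub>M ?I (\<lambda>_. \<omega>))" for z
    unfolding A_def by measurable
  have fubini: "(\<integral>w. g (perturb z w) \<partial>\<Omega>) = (\<integral>x. A z x \<partial>Pi\<^sub>M ?I (\<lambda>_. \<omega>))" for z
    using \<omega>.product_integral_insert[of ?I i "\<lambda>w. g (perturb z w)"] integrable_perturb[OF g]
    by (simp add: ins A_def)
  \<comment> \<open>The observable as a function of coordinate \<open>i\<close> on the circle, the
    other coordinates sitting at their perturbed positions.\<close>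
  define g' where "g' x v = g (\<chi> j. if j = i then v else to_circle (x j + y j))" for x v
  have g'_lip: "\<bar>g' x v - g' x v'\<bar> \<le> Lip_coord i g * dist v v'" for x v v'
    unfolding g'_def using le_Lip_coord_mult[OF g, of i "\<chi> j. if j = i then v else to_circle (x j + y j)"
        "\<chi> j. if j = i then v' else to_circle (x j + y j)"] by simp
  have g'_meas: "g' x \<in> borel_measurable borel" for x unfolding g'_def by measurable
  have g'_bd: "\<bar>g' x v\<bar> \<le> ?B" for x v unfolding g'_def by (rule lipschitz_abs_le[OF g])
  have A_eq: "A (y(i := b)) x = (\<integral>v. g' x (to_circle (v + b)) \<partial>\<omega>)" for b x
    unfolding A_def g'_def perturb_def
    by (intro Bochner_Integration.integral_cong refl arg_cong[where f = g]) (simp add: vec_eq_iff)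
  have A_int: "integrable (Pi\<^sub>M ?I (\<lambda>_. \<omega>)) (A (y(i := b)))" for b
  proof (rule R.bounded_expectation)
    show "\<bar>A (y(i := b)) x\<bar> \<le> ?B" for x
      unfolding A_eq
      by (intro \<omega>.M.bounded_expectation g'_bd) (rule measurable_compose[OF _ g'_meas], measurable)
  qed simp
  \<comment> \<open>Writing \<open>y\<close> as \<open>y(i := y i)\<close> gives both terms the form
    of \<open>A_eq\<close>, with the same \<open>g'\<close> and only the shift changed.\<close>
  have "\<bar>A (y(i := y i)) x - A (y(i := a)) x\<bar> \<le> ?K" for x
    unfolding A_eq by (rule noise_contraction[OF g'_meas g'_bd g'_lip])
  then have "\<bar>\<integral>x. A (y(i := y i)) x - A (y(i := a)) x \<partial>Pi\<^sub>M ?I (\<lambda>_. \<omega>)\<bar> \<le> ?K"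
    by (intro R.bounded_expectation borel_measurable_diff A_meas)
  then have "\<bar>(\<integral>w. g (perturb (y(i := y i)) w) \<partial>\<Omega>) - (\<integral>w. g (perturb (y(i := a)) w) \<partial>\<Omega>)\<bar> \<le> ?K"
    unfolding fubini by (simp add: A_int del: fun_upd_triv)
  then show "\<bar>(\<integral>w. g (perturb y w) \<partial>\<Omega>) - (\<integral>w. g (perturb (y(i := a)) w) \<partial>\<Omega>)\<bar> \<le> ?K"
    by simp
qed

text \<open>McDiarmid's bound: changing one noise coordinate moves one point of the circle by at
  most 1, hence \<open>g\<close> by at most \<open>Lip_coord i g\<close>.\<close>

lemma perturb_exp_bound:
  fixes g :: "circle ^ 'n::finite \<Rightarrow> real"
  assumes g: "is_lipschitz g"
  shows "(\<integral>\<^sup>+w. ennreal (exp (l * (g (perturb y w) - (\<integral>w. g (perturb y w) \<partial>\<Omega>)))) \<partial>\<Omega>)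
    \<le> ennreal (exp (l\<^sup>2 / 8 * (\<Sum>i\<in>UNIV. (Lip_coord i g)\<^sup>2)))"
proof (rule product_prob_space.McDiarmid_exp_bound[OF product_prob_space_noise])
  note [measurable] = is_lipschitz_measurable[OF g]
  show "(\<lambda>w. g (perturb y w)) \<in> borel_measurable \<Omega>" by measurable
  show "\<bar>g (perturb y w)\<bar> \<le> \<bar>g undefined\<bar> + Lip_sum g" for w by (rule lipschitz_abs_le[OF g])
  show "\<bar>g (perturb y w) - g (perturb y (w(i := v)))\<bar> \<le> Lip_coord i g" for w i v
  proof -
    have "\<bar>g (perturb y w) - g (perturb y (w(i := v)))\<bar>
      \<le> Lip_coord i g * dist (perturb y w $ i) (perturb y (w(i := v)) $ i)"
      by (rule le_Lip_coord_mult[OF g]) simp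
    also have "\<dots> \<le> Lip_coord i g * 1"
      by (intro mult_left_mono dist_circle_le_1 Lip_coord_nonneg g)
    finally show ?thesis by simp
  qed
qed simp

end

section \<open>The transfer operator\<close>

text \<open>Sub-Gaussianity with a variance factor \<open>K\<close>, which is what the dynamics
  improves; \<open>K = 1\<close> is \<open>sub_gaussian\<close>. The nonnegative integral spares
  integrability arguments in Tonelli's theorem.\<close>

definition sub_gaussian_const :: "real \<Rightarrow> (circle ^ 'n::finite) measure \<Rightarrow> bool" where
  "sub_gaussian_const K \<mu> \<longleftrightarrow> \<mu> \<in> borel_probs \<and>
     (\<forall>g l. is_lipschitz g \<longrightarrow>
        (\<integral>\<^sup>+x. ennreal (exp (l * (g x - (\<integral>y. g y \<partial>\<mu>)))) \<partial>\<mu>)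
          \<le> ennreal (exp (K * l\<^sup>2 / 2 * (\<Sum>i\<in>UNIV. (Lip_coord i g)\<^sup>2))))"

lemma nn_integral_exp_lipschitz:
  fixes g :: "circle ^ 'n::finite \<Rightarrow> real"
  assumes g: "is_lipschitz g" and \<mu>: "\<mu> \<in> borel_probs"
  shows "(\<integral>\<^sup>+x. ennreal (exp (l * (g x - m))) \<partial>\<mu>) = ennreal (\<integral>x. exp (l * (g x - m)) \<partial>\<mu>)"
proof -
  interpret prob_space \<mu> using \<mu> by (simp add: borel_probs_def)
  have [measurable_cong]: "sets \<mu> = sets borel" using \<mu> by (simp add: borel_probs_def)
  note [measurable] = is_lipschitz_measurable[OF g]
  have "l * (g x - m) \<le> \<bar>l\<bar> * (\<bar>g undefined\<bar> + Lip_sum g + \<bar>m\<bar>)" for x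
  proof -
    have "l * (g x - m) \<le> \<bar>l\<bar> * \<bar>g x - m\<bar>" by (metis abs_ge_self abs_mult)
    also have "\<dots> \<le> \<bar>l\<bar> * (\<bar>g undefined\<bar> + Lip_sum g + \<bar>m\<bar>)"
      using lipschitz_abs_le[OF g, of x] by (intro mult_left_mono) auto
    finally show ?thesis .
  qed
  then have "integrable \<mu> (\<lambda>x. exp (l * (g x - m)))"
    by (intro integrable_const_bound[where B = "exp (\<bar>l\<bar> * (\<bar>g undefined\<bar> + Lip_sum g + \<bar>m\<bar>))"]) auto
  then show ?thesis by (rule nn_integral_eq_integral) simp
qed

lemma sub_gaussian_const_1: "sub_gaussian_const 1 \<mu> \<longleftrightarrow> sub_gaussian \<mu>"
  unfolding sub_gaussian_const_def sub_gaussian_def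
  by (auto simp: nn_integral_exp_lipschitz)

lemma Lip_sum_power2_le:
  fixes g :: "circle ^ 'n::finite \<Rightarrow> real"
  shows "(Lip_sum g)\<^sup>2 \<le> real CARD('n) * (\<Sum>i\<in>UNIV. (Lip_coord i g)\<^sup>2)"
  unfolding Lip_sum_def
  using Cauchy_Schwarz_ineq_sum[of "\<lambda>_. 1" "\<lambda>i. Lip_coord i g" UNIV] by simp

text \<open>The starting value for the iteration at the fixed point: Hoeffding with oscillation
  \<open>Lip_sum g\<close>, then Cauchy-Schwarz to reach the sum of squares.\<close>

lemma sub_gaussian_const_CARD:
  fixes \<mu> :: "(circle ^ 'n::finite) measure"
  assumes \<mu>: "\<mu> \<in> borel_probs"
  shows "sub_gaussian_const (real CARD('n)) \<mu>"
  unfolding sub_gaussian_const_def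
proof (intro conjI allI impI \<mu>)
  fix g :: "circle ^ 'n \<Rightarrow> real" and l :: real
  assume g: "is_lipschitz g"
  interpret prob_space \<mu> using \<mu> by (simp add: borel_probs_def)
  have [measurable_cong]: "sets \<mu> = sets borel" using \<mu> by (simp add: borel_probs_def)
  note [measurable] = is_lipschitz_measurable[OF g]
  let ?S = "\<Sum>i\<in>UNIV. (Lip_coord i g)\<^sup>2"
  have "(\<integral>\<^sup>+x. ennreal (exp (l * (g x - (\<integral>y. g y \<partial>\<mu>)))) \<partial>\<mu>) \<le> ennreal (exp (l\<^sup>2 * (Lip_sum g)\<^sup>2 / 8))"
    by (rule Hoeffding_exp_bound) (use abs_diff_le_Lip_sum[OF g] in \<open>auto simp: abs_le_iff\<close>)
  also have "\<dots> \<le> ennreal (exp (real CARD('n) * l\<^sup>2 / 2 * ?S))"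
  proof (intro ennreal_leI, subst exp_le_cancel_iff)
    have "l\<^sup>2 * (Lip_sum g)\<^sup>2 \<le> l\<^sup>2 * (real CARD('n) * ?S)"
      by (intro mult_left_mono Lip_sum_power2_le) simp
    \<comment> \<open>Nonnegativity allows the factor 1/8 from Hoeffding to be weakened to
      1/2.\<close>
    moreover have "0 \<le> l\<^sup>2 * (real CARD('n) * ?S)" by (simp add: sum_nonneg)
    ultimately show "l\<^sup>2 * (Lip_sum g)\<^sup>2 / 8 \<le> real CARD('n) * l\<^sup>2 / 2 * ?S" by (simp add: mult_ac)
  qed
  finally show "(\<integral>\<^sup>+x. ennreal (exp (l * (g x - (\<integral>y. g y \<partial>\<mu>)))) \<partial>\<mu>)
    \<le> ennreal (exp (real CARD('n) * l\<^sup>2 / 2 * ?S))" .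
qed

lemma sub_gaussian_const_mono:
  assumes "sub_gaussian_const K \<mu>" "K \<le> K'"
  shows "sub_gaussian_const K' \<mu>"
proof -
  have "K * l\<^sup>2 / 2 * (\<Sum>i\<in>UNIV. (Lip_coord i g)\<^sup>2) \<le> K' * l\<^sup>2 / 2 * (\<Sum>i\<in>UNIV. (Lip_coord i g)\<^sup>2)"
    for l and g :: "circle ^ 'a \<Rightarrow> real"
    using assms(2) by (intro mult_right_mono divide_right_mono sum_nonneg) auto
  then show ?thesis
    using assms(1) unfolding sub_gaussian_const_def
    by (meson ennreal_leI exp_le_cancel_iff order_trans)
qed

section \<open>The coupled map: drift, transition density and one random step\<close>

locale coupled_map = noise +
  fixes f :: "circle \<Rightarrow> real" and h :: "circle \<times> circle \<Rightarrow> real"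
  assumes f_lipschitz: "is_lipschitz f" and h_lipschitz: "is_lipschitz h"
begin

definition drift :: "circle ^ 'n::finite \<Rightarrow> 'n \<Rightarrow> real" where
  "drift u j = f (u $ j) + 1 / real CARD('n) * (\<Sum>k\<in>UNIV. h (u $ j, u $ k))"

definition \<kappa> :: real where
  "\<kappa> = (1 - c) * (Lip f + Lip1 h + Lip2 h)"

lemma \<kappa>_nonneg: "0 \<le> \<kappa>"
  unfolding \<kappa>_def using c_le_1 f_lipschitz h_lipschitz by (simp add: Lip_nonneg Lip1_nonneg Lip2_nonneg)

text \<open>In each interaction term the first argument is moved, then the second. Averaging leaves
  the full weight \<open>Lip1 h\<close> on site \<open>j\<close> and spreads \<open>Lip2 h\<close>
  evenly over all sites.\<close>

lemma drift_lipschitz: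
  fixes u u' :: "circle ^ 'n::finite"
  shows "\<bar>drift u j - drift u' j\<bar> \<le> (Lip f + Lip1 h) * dist (u $ j) (u' $ j)
    + Lip2 h / real CARD('n) * (\<Sum>k\<in>UNIV. dist (u $ k) (u' $ k))"
proof -
  let ?N = "real CARD('n)" and ?d = "\<lambda>k. dist (u $ k) (u' $ k)"
  have h: "\<bar>h (u $ j, u $ k) - h (u' $ j, u' $ k)\<bar> \<le> Lip1 h * ?d j + Lip2 h * ?d k" for k
    using le_Lip1_mult[OF h_lipschitz, of "u $ j" "u $ k" "u' $ j"]
      le_Lip2_mult[OF h_lipschitz, of "u' $ j" "u $ k" "u' $ k"] by linarith
  have "\<bar>(\<Sum>k\<in>UNIV. h (u $ j, u $ k)) - (\<Sum>k\<in>UNIV. h (u' $ j, u' $ k))\<bar>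
    \<le> (\<Sum>k\<in>UNIV. \<bar>h (u $ j, u $ k) - h (u' $ j, u' $ k)\<bar>)"
    unfolding sum_subtractf[symmetric] by (rule sum_abs)
  also have "\<dots> \<le> (\<Sum>k\<in>UNIV. Lip1 h * ?d j + Lip2 h * ?d k)"
    by (intro sum_mono h)
  also have "\<dots> = ?N * (Lip1 h * ?d j) + Lip2 h * (\<Sum>k\<in>UNIV. ?d k)"
    by (simp add: sum.distrib sum_distrib_left)
  finally have "1 / ?N * \<bar>(\<Sum>k\<in>UNIV. h (u $ j, u $ k)) - (\<Sum>k\<in>UNIV. h (u' $ j, u' $ k))\<bar>
    \<le> 1 / ?N * (?N * (Lip1 h * ?d j) + Lip2 h * (\<Sum>k\<in>UNIV. ?d k))"
    by (intro mult_left_mono) auto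
  also have "\<dots> = Lip1 h * ?d j + Lip2 h / ?N * (\<Sum>k\<in>UNIV. ?d k)"
    by (simp add: field_simps)
  finally have "\<bar>1 / ?N * (\<Sum>k\<in>UNIV. h (u $ j, u $ k)) - 1 / ?N * (\<Sum>k\<in>UNIV. h (u' $ j, u' $ k))\<bar>
    \<le> Lip1 h * ?d j + Lip2 h / ?N * (\<Sum>k\<in>UNIV. ?d k)"
    unfolding right_diff_distrib[symmetric] abs_mult by simp
  then show ?thesis
    unfolding drift_def using le_Lip_mult[OF f_lipschitz, of "u $ j" "u' $ j"]
    by (simp only: distrib_right)
qed

lemma drift_measurable [measurable]: "(\<lambda>u::circle ^ 'n::finite. drift u j) \<in> borel_measurable borel"
proof -
  have cont: "continuous_on UNIV f" "continuous_on UNIV h"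
    using f_lipschitz h_lipschitz by (auto simp: is_lipschitz_def dest: lipschitz_on_continuous_on)
  have "continuous_on UNIV (\<lambda>u::circle ^ 'n. f (u $ j))"
    by (rule continuous_on_compose2[OF cont(1)]) (auto intro: continuous_intros)
  moreover have "continuous_on UNIV (\<lambda>u::circle ^ 'n. h (u $ j, u $ k))" for k
    by (rule continuous_on_compose2[OF cont(2)]) (auto intro!: continuous_intros)
  ultimately show ?thesis
    unfolding drift_def by (intro borel_measurable_continuous_onI continuous_intros)
qed

definition kernel :: "circle ^ 'n::finite \<Rightarrow> circle ^ 'n \<Rightarrow> ennreal" where
  "kernel u x = (\<Prod>j\<in>UNIV. ennreal (p (circle_rep (x $ j) - drift u j)))"

lemma kernel_measurable [measurable]:
  "(\<lambda>(u, x). kernel u x) \<in> borel_measurable ((borel :: (circle ^ 'n::finite) measure) \<Otimes>\<^sub>M borel)"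
  unfolding kernel_def by measurable

lemma transfer_op_eq: "transfer_op f h p \<mu> = density torus_lebesgue (\<lambda>x. \<integral>\<^sup>+u. kernel u x \<partial>\<mu>)"
  by (simp add: transfer_op_def kernel_def drift_def diff_diff_eq)

lemma density_kernel: "density torus_lebesgue (kernel u) = distr \<Omega> borel (perturb (drift u))"
  unfolding kernel_def by (rule perturb_law[symmetric])

abbreviation step :: "(circle ^ 'n) \<times> ('n \<Rightarrow> real) \<Rightarrow> circle ^ 'n::finite" where
  "step \<equiv> \<lambda>(u, w). perturb (drift u) w"

lemma step_measurable [measurable]: "step \<in> (borel :: (circle ^ 'n::finite) measure) \<Otimes>\<^sub>M \<Omega> \<rightarrow>\<^sub>M borel"
  unfolding perturb_def by measurable

text \<open>By Tonelli the mixture of transition densities is the law of one random step from a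
  \<open>\<mu>\<close>-distributed state with independent noise.\<close>

lemma transfer_op_eq_distr:
  fixes \<mu> :: "(circle ^ 'n::finite) measure"
  assumes \<mu>: "\<mu> \<in> borel_probs"
  shows "transfer_op f h p \<mu> = distr (\<mu> \<Otimes>\<^sub>M \<Omega>) borel step"
proof (rule measure_eqI)
  fix A assume "A \<in> sets (transfer_op f h p \<mu>)"
  then have A [measurable]: "A \<in> sets borel" by (simp add: transfer_op_eq sets_torus_lebesgue)
  interpret \<mu>: prob_space \<mu> using \<mu> by (simp add: borel_probs_def)
  have [measurable_cong]: "sets \<mu> = sets borel" using \<mu> by (simp add: borel_probs_def)
  interpret T: prob_space "torus_lebesgue :: (circle ^ 'n) measure" by (rule prob_space_torus_lebesgue)
  interpret N: prob_space "\<Omega> :: ('n \<Rightarrow> real) measure" by (rule prob_space_\<Omega>)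
  interpret pair_sigma_finite \<mu> "torus_lebesgue :: (circle ^ 'n) measure" by unfold_locales
  have "emeasure (transfer_op f h p \<mu>) A = (\<integral>\<^sup>+x. (\<integral>\<^sup>+u. kernel u x \<partial>\<mu>) * indicator A x \<partial>torus_lebesgue)"
    unfolding transfer_op_eq by (rule emeasure_density) measurable
  also have "\<dots> = (\<integral>\<^sup>+x. \<integral>\<^sup>+u. kernel u x * indicator A x \<partial>\<mu> \<partial>torus_lebesgue)"
    by (intro nn_integral_cong nn_integral_multc[symmetric]) measurable
  also have "\<dots> = (\<integral>\<^sup>+u. \<integral>\<^sup>+x. kernel u x * indicator A x \<partial>torus_lebesgue \<partial>\<mu>)"
    by (rule Fubini') measurable
  also have "\<dots> = (\<integral>\<^sup>+u. emeasure (density torus_lebesgue (kernel u)) A \<partial>\<mu>)"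
    by (intro nn_integral_cong emeasure_density[symmetric]) measurable
  also have "\<dots> = (\<integral>\<^sup>+u. \<integral>\<^sup>+w. indicator A (step (u, w)) \<partial>\<Omega> \<partial>\<mu>)"
  proof (intro nn_integral_cong)
    fix u
    have "(\<integral>\<^sup>+w. indicator A (step (u, w)) \<partial>\<Omega>) = (\<integral>\<^sup>+x. indicator A x \<partial>distr \<Omega> borel (perturb (drift u)))"
      by (subst nn_integral_distr) simp_all
    then show "emeasure (density torus_lebesgue (kernel u)) A = (\<integral>\<^sup>+w. indicator A (step (u, w)) \<partial>\<Omega>)"
      by (simp add: density_kernel)
  qed
  also have "\<dots> = (\<integral>\<^sup>+z. indicator A (step z) \<partial>(\<mu> \<Otimes>\<^sub>M \<Omega>))"
    by (rule N.nn_integral_fst[where f = "\<lambda>z. indicator A (step z)"]) measurable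
  also have "\<dots> = (\<integral>\<^sup>+x. indicator A x \<partial>distr (\<mu> \<Otimes>\<^sub>M \<Omega>) borel step)"
    by (subst nn_integral_distr) measurable
  finally show "emeasure (transfer_op f h p \<mu>) A = emeasure (distr (\<mu> \<Otimes>\<^sub>M \<Omega>) borel step) A"
    by simp
qed (simp add: transfer_op_eq sets_torus_lebesgue)

lemma transfer_op_borel_probs:
  fixes \<mu> :: "(circle ^ 'n::finite) measure"
  assumes \<mu>: "\<mu> \<in> borel_probs"
  shows "transfer_op f h p \<mu> \<in> borel_probs"
proof -
  interpret \<mu>: prob_space \<mu> using \<mu> by (simp add: borel_probs_def)
  have [measurable_cong]: "sets \<mu> = sets borel" using \<mu> by (simp add: borel_probs_def)
  interpret N: prob_space "\<Omega> :: ('n \<Rightarrow> real) measure" by (rule prob_space_\<Omega>)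
  interpret pair_prob_space \<mu> "\<Omega> :: ('n \<Rightarrow> real) measure" by unfold_locales
  have "prob_space (distr (\<mu> \<Otimes>\<^sub>M \<Omega>) borel (step :: _ \<Rightarrow> circle ^ 'n))"
    by (rule prob_space_distr) measurable
  then show ?thesis by (simp add: transfer_op_eq_distr[OF \<mu>] borel_probs_def)
qed

section \<open>The dual operator on observables, called \<open>Q\<close> in the overview, and its
  Lipschitz constants\<close>

definition dual :: "(circle ^ 'n::finite \<Rightarrow> real) \<Rightarrow> circle ^ 'n \<Rightarrow> real" where
  "dual g u = (\<integral>w. g (perturb (drift u) w) \<partial>\<Omega>)"

lemma integral_transfer_op:
  fixes g :: "circle ^ 'n::finite \<Rightarrow> real"
  assumes g: "is_lipschitz g" and \<mu>: "\<mu> \<in> borel_probs"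
  shows "(\<integral>x. g x \<partial>transfer_op f h p \<mu>) = (\<integral>u. dual g u \<partial>\<mu>)"
proof -
  interpret \<mu>: prob_space \<mu> using \<mu> by (simp add: borel_probs_def)
  have [measurable_cong]: "sets \<mu> = sets borel" using \<mu> by (simp add: borel_probs_def)
  interpret N: prob_space "\<Omega> :: ('n \<Rightarrow> real) measure" by (rule prob_space_\<Omega>)
  interpret pair_prob_space \<mu> "\<Omega> :: ('n \<Rightarrow> real) measure" by unfold_locales
  note [measurable] = is_lipschitz_measurable[OF g]
  have int: "integrable (\<mu> \<Otimes>\<^sub>M \<Omega>) (\<lambda>z. g (step z))"
    by (rule bounded_expectation(1)[OF _ lipschitz_abs_le[OF g]]) measurable
  have "(\<integral>x. g x \<partial>transfer_op f h p \<mu>) = (\<integral>z. g (step z) \<partial>(\<mu> \<Otimes>\<^sub>M \<Omega>))"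
    unfolding transfer_op_eq_distr[OF \<mu>] by (rule integral_distr) measurable
  also have "\<dots> = (\<integral>u. dual g u \<partial>\<mu>)"
    using integral_fst'[OF int] by (simp add: dual_def)
  finally show ?thesis .
qed

text \<open>The matrix of the overview applied to the vector of the \<open>Lip_coord j g\<close>;
  the mean-field entries add up to \<open>Lip_sum g\<close>.\<close>

definition dual_Lip :: "(circle ^ 'n::finite \<Rightarrow> real) \<Rightarrow> 'n \<Rightarrow> real" where
  "dual_Lip g k = (1 - c) * ((Lip f + Lip1 h) * Lip_coord k g + Lip2 h / real CARD('n) * Lip_sum g)"

text \<open>The noise contraction reduces to drift differences, these to distances. Collecting the
  coefficient of the distance at \<open>k\<close> gives a diagonal term from site \<open>k\<close>
  and a mean-field term from every site.\<close>

lemma dual_abs_diff: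
  fixes g :: "circle ^ 'n::finite \<Rightarrow> real"
  assumes g: "is_lipschitz g"
  shows "\<bar>dual g u - dual g u'\<bar> \<le> (\<Sum>k\<in>UNIV. dual_Lip g k * dist (u $ k) (u' $ k))"
proof -
  let ?d = "\<lambda>k. dist (u $ k) (u' $ k)" and ?b = "Lip2 h / real CARD('n)" and ?a = "Lip f + Lip1 h"
  have "\<bar>dual g u - dual g u'\<bar> \<le> (\<Sum>j\<in>UNIV. (1 - c) * Lip_coord j g * \<bar>drift u j - drift u' j\<bar>)"
    unfolding dual_def by (rule perturb_contraction[OF g])
  also have "\<dots> \<le> (\<Sum>j\<in>UNIV. (1 - c) * Lip_coord j g * (?a * ?d j + ?b * (\<Sum>k\<in>UNIV. ?d k)))"
    using c_le_1 by (intro sum_mono mult_left_mono drift_lipschitz mult_nonneg_nonneg Lip_coord_nonneg g) auto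
  also have "\<dots> = (\<Sum>j\<in>UNIV. (1 - c) * ?a * Lip_coord j g * ?d j + (1 - c) * ?b * (\<Sum>k\<in>UNIV. ?d k) * Lip_coord j g)"
    by (intro sum.cong refl) (simp only: distrib_left distrib_right mult_ac add_ac)
  also have "\<dots> = (\<Sum>j\<in>UNIV. (1 - c) * ?a * Lip_coord j g * ?d j) + (1 - c) * ?b * Lip_sum g * (\<Sum>k\<in>UNIV. ?d k)"
    unfolding sum.distrib sum_distrib_left[symmetric] by (simp only: Lip_sum_def mult_ac)
  also have "\<dots> = (\<Sum>k\<in>UNIV. dual_Lip g k * ?d k)"
    unfolding dual_Lip_def sum_distrib_left sum.distrib[symmetric]
    by (intro sum.cong refl) (simp add: algebra_simps)
  finally show ?thesis .
qed

lemma dual_Lip_nonneg: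
  assumes g: "is_lipschitz g"
  shows "0 \<le> dual_Lip g k"
  unfolding dual_Lip_def Lip_sum_def using c_le_1 f_lipschitz h_lipschitz g
  by (intro mult_nonneg_nonneg add_nonneg_nonneg sum_nonneg divide_nonneg_nonneg
      Lip_nonneg Lip1_nonneg Lip2_nonneg Lip_coord_nonneg) auto

lemma is_lipschitz_dual: "is_lipschitz g \<Longrightarrow> is_lipschitz (dual g)"
  and Lip_coord_dual_le: "is_lipschitz g \<Longrightarrow> Lip_coord k (dual g) \<le> dual_Lip g k"
  by (rule is_lipschitz_if_sum_bound[OF dual_Lip_nonneg dual_abs_diff]; assumption)+

text \<open>The \<open>l1\<close> norm of the matrix: summing over all sites turns the mean-field
  weight \<open>Lip2 h / N\<close> into \<open>Lip2 h\<close>.\<close>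

lemma Lip_sum_dual_le:
  fixes g :: "circle ^ 'n::finite \<Rightarrow> real"
  assumes g: "is_lipschitz g"
  shows "Lip_sum (dual g) \<le> \<kappa> * Lip_sum g"
proof -
  have "Lip_sum (dual g) \<le> (\<Sum>k\<in>UNIV. dual_Lip g k)"
    unfolding Lip_sum_def by (intro sum_mono Lip_coord_dual_le g)
  also have "\<dots> = (1 - c) * ((Lip f + Lip1 h) * Lip_sum g + Lip2 h * Lip_sum g)"
    unfolding dual_Lip_def sum_distrib_left[symmetric] sum.distrib by (simp add: Lip_sum_def)
  also have "\<dots> = \<kappa> * Lip_sum g" by (simp add: \<kappa>_def algebra_simps)
  finally show ?thesis .
qed

text \<open>The \<open>l2\<close> norm of the matrix. After expanding the squares the mean-field
  terms carry \<open>(Lip_sum g)^2 / N\<close>, which Cauchy-Schwarz bounds by the sum of squares,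
  so the coefficients combine to the square of \<open>\<kappa>\<close>.\<close>

lemma sum_Lip_coord_dual_power2_le:
  fixes g :: "circle ^ 'n::finite \<Rightarrow> real"
  assumes g: "is_lipschitz g"
  shows "(\<Sum>k\<in>UNIV. (Lip_coord k (dual g))\<^sup>2) \<le> \<kappa>\<^sup>2 * (\<Sum>k\<in>UNIV. (Lip_coord k g)\<^sup>2)"
proof -
  let ?N = "real CARD('n)" and ?S = "Lip_sum g" and ?Q = "\<Sum>k\<in>UNIV. (Lip_coord k g)\<^sup>2"
  let ?a = "Lip f + Lip1 h" and ?b = "Lip2 h"
  have ab: "0 \<le> ?a" "0 \<le> ?b"
    using f_lipschitz h_lipschitz by (simp_all add: Lip_nonneg Lip1_nonneg Lip2_nonneg)
  have square: "(q * (a * x + b / n * s))\<^sup>2 = q\<^sup>2 * (a\<^sup>2 * x\<^sup>2 + (2 * a * b * s / n) * x + (b * s / n)\<^sup>2)"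
    for q a b x n s :: real by (simp add: power2_eq_square algebra_simps)
  have "(\<Sum>k\<in>UNIV. (Lip_coord k (dual g))\<^sup>2) \<le> (\<Sum>k\<in>UNIV. (dual_Lip g k)\<^sup>2)"
    by (intro sum_mono power_mono Lip_coord_dual_le Lip_coord_nonneg is_lipschitz_dual g)
  also have "\<dots> = (\<Sum>k\<in>UNIV. (1 - c)\<^sup>2 * (?a\<^sup>2 * (Lip_coord k g)\<^sup>2 + (2 * ?a * ?b * ?S / ?N) * Lip_coord k g + (?b * ?S / ?N)\<^sup>2))"
    unfolding dual_Lip_def square ..
  also have "\<dots> = (1 - c)\<^sup>2 * (?a\<^sup>2 * ?Q + (2 * ?a * ?b * ?S / ?N) * ?S + ?N * (?b * ?S / ?N)\<^sup>2)"
    unfolding sum_distrib_left[symmetric] sum.distrib by (simp add: Lip_sum_def)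
  also have "\<dots> = (1 - c)\<^sup>2 * (?a\<^sup>2 * ?Q + (2 * ?a * ?b + ?b\<^sup>2) * (?S\<^sup>2 / ?N))"
    by (simp add: field_simps power2_eq_square)
  also have "\<dots> \<le> (1 - c)\<^sup>2 * (?a\<^sup>2 * ?Q + (2 * ?a * ?b + ?b\<^sup>2) * ?Q)"
    using ab Lip_sum_power2_le[of g]
    by (intro mult_left_mono add_left_mono) (auto simp: divide_le_eq mult.commute)
  also have "\<dots> = \<kappa>\<^sup>2 * ?Q" by (simp add: \<kappa>_def power2_eq_square algebra_simps)
  finally show ?thesis .
qed

section \<open>Contraction, propagation of sub-Gaussianity and the fixed point\<close>

lemma W1_transfer_op_le:
  fixes \<mu> \<nu> :: "(circle ^ 'n::finite) measure"
  assumes mn: "\<mu> \<in> borel_probs" "\<nu> \<in> borel_probs"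
  shows "W1 (transfer_op f h p \<mu>) (transfer_op f h p \<nu>) \<le> \<kappa> * W1 \<mu> \<nu>"
  unfolding W1_def[of "transfer_op f h p \<mu>"]
proof (rule cSup_least)
  \<comment> \<open>The zero function witnesses that the supremum runs over a nonempty set; its
    constant is bounded by viewing it as 0 times itself.\<close>
  have "Lip_sum (\<lambda>_::circle ^ 'n. 0 * (0 :: real)) \<le> 0 * Lip_sum (\<lambda>_::circle ^ 'n. 0)"
    by (rule is_lipschitz_scale(2)) (simp_all add: is_lipschitz_const)
  then have "Lip_sum (\<lambda>_::circle ^ 'n. 0) \<le> 1" by simp
  then show "{(\<integral>x. g x \<partial>transfer_op f h p \<mu>) - (\<integral>x. g x \<partial>transfer_op f h p \<nu>) | g.
      is_lipschitz g \<and> Lip_sum g \<le> 1} \<noteq> {}"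
    using is_lipschitz_const[of 0] by blast
next
  fix r assume "r \<in> {(\<integral>x. g x \<partial>transfer_op f h p \<mu>) - (\<integral>x. g x \<partial>transfer_op f h p \<nu>) | g.
      is_lipschitz g \<and> Lip_sum g \<le> 1}"
  then obtain g where r: "r = (\<integral>x. g x \<partial>transfer_op f h p \<mu>) - (\<integral>x. g x \<partial>transfer_op f h p \<nu>)"
    and g: "is_lipschitz g" "Lip_sum g \<le> 1" by blast
  \<comment> \<open>By duality, testing the images against \<open>g\<close> is testing the original
    measures against \<open>dual g\<close>, so this bound yields the factor
    \<open>\<kappa>\<close>.\<close>
  have "Lip_sum (dual g) \<le> \<kappa>"
    using Lip_sum_dual_le[OF g(1)] mult_left_mono[OF g(2) \<kappa>_nonneg] by simp
  then show "r \<le> \<kappa> * W1 \<mu> \<nu>"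
    unfolding r integral_transfer_op[OF g(1) mn(1)] integral_transfer_op[OF g(1) mn(2)]
    by (intro integral_diff_le_W1 is_lipschitz_dual g mn)
qed

text \<open>Conditioning on the previous state, the noise contributes \<open>1/4\<close> (McDiarmid, as the circle has
  diameter at most 1), and the conditional mean has Lipschitz constants contracted by \<open>\<kappa>\<close>
  in \<open>\<ell>\<^sup>2\<close>.\<close>

lemma sub_gaussian_const_transfer_op:
  fixes \<mu> :: "(circle ^ 'n::finite) measure"
  assumes sg: "sub_gaussian_const K \<mu>" and "0 \<le> K"
  shows "sub_gaussian_const (1/4 + \<kappa>\<^sup>2 * K) (transfer_op f h p \<mu>)"
  unfolding sub_gaussian_const_def
proof (intro conjI allI impI)
  have \<mu>: "\<mu> \<in> borel_probs" using sg by (simp add: sub_gaussian_const_def)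
  then show "transfer_op f h p \<mu> \<in> borel_probs" by (rule transfer_op_borel_probs)
  fix g :: "circle ^ 'n \<Rightarrow> real" and l :: real
  assume g: "is_lipschitz g"
  interpret \<mu>: prob_space \<mu> using \<mu> by (simp add: borel_probs_def)
  have [measurable_cong]: "sets \<mu> = sets borel" using \<mu> by (simp add: borel_probs_def)
  interpret N: prob_space "\<Omega> :: ('n \<Rightarrow> real) measure" by (rule prob_space_\<Omega>)
  interpret pair_prob_space \<mu> "\<Omega> :: ('n \<Rightarrow> real) measure" by unfold_locales
  note [measurable] = is_lipschitz_measurable[OF g] is_lipschitz_measurable[OF is_lipschitz_dual[OF g]]
  let ?m = "\<integral>x. g x \<partial>transfer_op f h p \<mu>" and ?S = "\<Sum>i\<in>UNIV. (Lip_coord i g)\<^sup>2"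
  have mean: "?m = (\<integral>u. dual g u \<partial>\<mu>)" by (rule integral_transfer_op[OF g \<mu>])
  have inner: "(\<integral>\<^sup>+w. ennreal (exp (l * (g (step (u, w)) - ?m))) \<partial>\<Omega>)
    \<le> ennreal (exp (l\<^sup>2 / 8 * ?S)) * ennreal (exp (l * (dual g u - ?m)))" for u
  proof -
    have "(\<integral>\<^sup>+w. ennreal (exp (l * (g (step (u, w)) - ?m))) \<partial>\<Omega>)
      = (\<integral>\<^sup>+w. ennreal (exp (l * (g (perturb (drift u) w) - dual g u))) * ennreal (exp (l * (dual g u - ?m))) \<partial>\<Omega>)"
      by (intro nn_integral_cong) (simp add: algebra_simps flip: ennreal_mult exp_add)
    also have "\<dots> = (\<integral>\<^sup>+w. ennreal (exp (l * (g (perturb (drift u) w) - dual g u))) \<partial>\<Omega>) * ennreal (exp (l * (dual g u - ?m)))"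
      by (rule nn_integral_multc) measurable
    also have "\<dots> \<le> ennreal (exp (l\<^sup>2 / 8 * ?S)) * ennreal (exp (l * (dual g u - ?m)))"
      unfolding dual_def by (intro mult_right_mono perturb_exp_bound g) simp
    finally show ?thesis .
  qed
  have "(\<integral>\<^sup>+x. ennreal (exp (l * (g x - ?m))) \<partial>transfer_op f h p \<mu>)
    = (\<integral>\<^sup>+z. ennreal (exp (l * (g (step z) - ?m))) \<partial>(\<mu> \<Otimes>\<^sub>M \<Omega>))"
    by (subst (1) transfer_op_eq_distr[OF \<mu>], rule nn_integral_distr) measurable
  also have "\<dots> = (\<integral>\<^sup>+u. \<integral>\<^sup>+w. ennreal (exp (l * (g (step (u, w)) - ?m))) \<partial>\<Omega> \<partial>\<mu>)"
    by (rule N.nn_integral_fst[symmetric, where f = "\<lambda>z. ennreal (exp (l * (g (step z) - ?m)))"]) measurable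
  also have "\<dots> \<le> (\<integral>\<^sup>+u. ennreal (exp (l\<^sup>2 / 8 * ?S)) * ennreal (exp (l * (dual g u - ?m))) \<partial>\<mu>)"
    by (intro nn_integral_mono inner)
  also have "\<dots> = ennreal (exp (l\<^sup>2 / 8 * ?S)) * (\<integral>\<^sup>+u. ennreal (exp (l * (dual g u - ?m))) \<partial>\<mu>)"
    by (rule nn_integral_cmult) measurable
  also have "\<dots> \<le> ennreal (exp (l\<^sup>2 / 8 * ?S)) * ennreal (exp (K * l\<^sup>2 / 2 * (\<Sum>i\<in>UNIV. (Lip_coord i (dual g))\<^sup>2)))"
    unfolding mean using sg is_lipschitz_dual[OF g]
    by (intro mult_left_mono) (auto simp: sub_gaussian_const_def)
  also have "\<dots> \<le> ennreal (exp (l\<^sup>2 / 8 * ?S)) * ennreal (exp (K * l\<^sup>2 / 2 * (\<kappa>\<^sup>2 * ?S)))"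
    using \<open>0 \<le> K\<close> sum_Lip_coord_dual_power2_le[OF g]
    by (intro mult_left_mono ennreal_leI) (auto intro: mult_left_mono)
  \<comment> \<open>The noise factor 1/8 is 1/4 times the normalising 1/2, whence the summand
    1/4.\<close>
  also have "\<dots> = ennreal (exp ((1/4 + \<kappa>\<^sup>2 * K) * l\<^sup>2 / 2 * ?S))"
    by (simp add: algebra_simps flip: ennreal_mult exp_add)
  finally show "(\<integral>\<^sup>+x. ennreal (exp (l * (g x - ?m))) \<partial>transfer_op f h p \<mu>)
    \<le> ennreal (exp ((1/4 + \<kappa>\<^sup>2 * K) * l\<^sup>2 / 2 * ?S))" .
qed

text \<open>The transition density is a product of one factor above \<open>c\<close> per site, so
  Doeblin's minorisation holds with \<open>c ^ CARD('n)\<close>.\<close>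

lemma transfer_op_fixed_point:
  "\<exists>\<rho> :: (circle ^ 'n::finite) measure. \<rho> \<in> borel_probs \<and> transfer_op f h p \<rho> = \<rho> \<and>
    (\<forall>\<rho>'\<in>borel_probs. transfer_op f h p \<rho>' = \<rho>' \<longrightarrow> \<rho>' = \<rho>)"
proof -
  interpret T: prob_space "torus_lebesgue :: (circle ^ 'n) measure" by (rule prob_space_torus_lebesgue)
  have lower: "ennreal (c ^ CARD('n)) \<le> kernel u x" for u x :: "circle ^ 'n"
  proof -
    have "c ^ CARD('n) \<le> (\<Prod>j\<in>UNIV. p (circle_rep (x $ j) - drift u j))"
      using prod_mono[of UNIV "\<lambda>_. c" "\<lambda>j. p (circle_rep (x $ j) - drift u j)"] c_pos c_less_p
      by (simp add: less_imp_le)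
    then show ?thesis by (simp add: kernel_def prod_ennreal p_nonneg ennreal_leI)
  qed
  have mass: "(\<integral>\<^sup>+x. kernel u x \<partial>torus_lebesgue) = 1" for u :: "circle ^ 'n"
  proof -
    have "kernel u \<in> borel_measurable torus_lebesgue" by measurable
    then have "(\<integral>\<^sup>+x. kernel u x \<partial>torus_lebesgue) = emeasure (density torus_lebesgue (kernel u)) (space torus_lebesgue)"
      by (subst emeasure_density) (auto intro!: nn_integral_cong)
    also have "\<dots> = emeasure (distr \<Omega> borel (perturb (drift u))) (space (distr \<Omega> borel (perturb (drift u))))"
      unfolding density_kernel[symmetric] by simp
    also have "\<dots> = 1"
      by (intro prob_space.emeasure_space_1 prob_space.prob_space_distr prob_space_\<Omega> perturb_measurable)
    finally show ?thesis .
  qed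
  have "(\<lambda>(u, x). kernel u x) \<in> borel_measurable ((torus_lebesgue :: (circle ^ 'n) measure) \<Otimes>\<^sub>M torus_lebesgue)"
    by measurable
  from T.Doeblin_fixed_point[OF this zero_less_power[OF c_pos] lower mass]
  show ?thesis by (auto simp: borel_probs_def sets_torus_lebesgue transfer_op_eq)
qed

text \<open>The constant 1 is kept as soon as \<open>1/4 + \<kappa>\<^sup>2\<close> is at most 1;
  this is the origin of the threshold \<open>sqrt 3 / 2\<close>.\<close>

lemma sub_gaussian_transfer_op:
  assumes "\<kappa>\<^sup>2 \<le> 3/4" and "sub_gaussian \<mu>"
  shows "sub_gaussian (transfer_op f h p \<mu>)"
proof -
  have *: "sub_gaussian_const (1/4 + \<kappa>\<^sup>2 * 1) (transfer_op f h p \<mu>)"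
    using assms by (intro sub_gaussian_const_transfer_op) (simp_all add: sub_gaussian_const_1)
  then have "sub_gaussian_const 1 (transfer_op f h p \<mu>)"
    by (rule sub_gaussian_const_mono) (use assms in simp)
  then show ?thesis by (simp add: sub_gaussian_const_1)
qed

text \<open>Every measure is sub-Gaussian with the constant \<open>CARD('n)\<close>; stationarity improves the
  constant by the affine contraction \<open>K \<mapsto> 1/4 + 3/4 K\<close>, whose fixed point is 1.\<close>

lemma sub_gaussian_fixed_point:
  fixes \<rho> :: "(circle ^ 'n::finite) measure"
  assumes \<kappa>: "\<kappa>\<^sup>2 \<le> 3/4" and \<rho>: "\<rho> \<in> borel_probs" and stationary: "transfer_op f h p \<rho> = \<rho>"
  shows "sub_gaussian \<rho>"
proof -
  \<comment> \<open>The explicit solution of \<open>K (n+1) = 1/4 + 3/4 * K n\<close> that starts at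
    \<open>CARD('n)\<close>.\<close>
  define K where "K n = 1 + (real CARD('n) - 1) * (3/4) ^ n" for n
  have card: "1 \<le> real CARD('n)" by (simp add: Suc_le_eq)
  have K: "sub_gaussian_const (K n) \<rho>" for n
  proof (induction n)
    case 0
    show ?case using sub_gaussian_const_CARD[OF \<rho>] by (simp add: K_def)
  next
    case (Suc n)
    have "0 \<le> K n" unfolding K_def using card by simp
    then have "1/4 + \<kappa>\<^sup>2 * K n \<le> 1/4 + 3/4 * K n" using \<kappa> by (intro add_left_mono mult_right_mono)
    also have "\<dots> = K (Suc n)" by (simp add: K_def field_simps)
    finally show ?case
      using sub_gaussian_const_transfer_op[OF Suc \<open>0 \<le> K n\<close>] unfolding stationary
      by (rule sub_gaussian_const_mono[rotated])
  qed
  have "K \<longlonglongrightarrow> 1 + (real CARD('n) - 1) * 0"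
    unfolding K_def by (intro tendsto_intros LIMSEQ_realpow_zero) auto
  then have lim: "K \<longlonglongrightarrow> 1" by simp
  have "sub_gaussian_const 1 \<rho>"
    unfolding sub_gaussian_const_def
  proof (intro conjI allI impI \<rho>)
    fix g :: "circle ^ 'n \<Rightarrow> real" and l :: real
    assume g: "is_lipschitz g"
    show "(\<integral>\<^sup>+x. ennreal (exp (l * (g x - (\<integral>y. g y \<partial>\<rho>)))) \<partial>\<rho>)
      \<le> ennreal (exp (1 * l\<^sup>2 / 2 * (\<Sum>i\<in>UNIV. (Lip_coord i g)\<^sup>2)))"
    \<comment> \<open>For fixed \<open>g\<close> and \<open>l\<close> the left-hand side does not
      depend on \<open>n\<close>, so the bounds with \<open>K n\<close> pass to the limit.\<close>
    proof (rule LIMSEQ_le_const)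
      show "(\<lambda>n. ennreal (exp (K n * l\<^sup>2 / 2 * (\<Sum>i\<in>UNIV. (Lip_coord i g)\<^sup>2))))
        \<longlonglongrightarrow> ennreal (exp (1 * l\<^sup>2 / 2 * (\<Sum>i\<in>UNIV. (Lip_coord i g)\<^sup>2)))"
        by (intro tendsto_ennrealI tendsto_intros lim) simp
    qed (use K g in \<open>auto simp: sub_gaussian_const_def\<close>)
  qed
  then show ?thesis by (simp add: sub_gaussian_const_1)
qed

end

theorem theorem1p2:
  fixes f :: "circle \<Rightarrow> real"
    and h :: "circle \<times> circle \<Rightarrow> real"
    and p :: "real \<Rightarrow> real"
    and c \<kappa> :: real
    and P :: "(circle ^ 'n::finite) measure \<Rightarrow> (circle ^ 'n) measure"
  assumes "is_lipschitz f"
    and "is_lipschitz h"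
    and "p \<in> borel_measurable borel"
    and "\<And>x. p (x + 1) = p x"
    and "(\<integral>\<^sup>+x\<in>{0..1}. ennreal (p x) \<partial>lborel) = 1"
    and "c > 0"
    and "\<And>x. x \<in> {0..1} \<Longrightarrow> p x > c"
    and "\<kappa> = (1 - c) * (Lip f + Lip1 h + Lip2 h)"
    and "\<kappa> < sqrt 3 / 2"
    and "CARD('n) \<ge> 2"
    and "P = transfer_op f h p"
  shows "(\<forall>\<mu>\<in>borel_probs. P \<mu> \<in> borel_probs)
    \<and> (\<forall>\<mu>. sub_gaussian \<mu> \<longrightarrow> sub_gaussian (P \<mu>))
    \<and> (\<forall>\<mu>\<^sub>1\<in>borel_probs. \<forall>\<mu>\<^sub>2\<in>borel_probs. W1 (P \<mu>\<^sub>1) (P \<mu>\<^sub>2) \<le> \<kappa> * W1 \<mu>\<^sub>1 \<mu>\<^sub>2)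
    \<and> (\<exists>\<rho>\<in>borel_probs. P \<rho> = \<rho> \<and> (\<forall>\<rho>'\<in>borel_probs. P \<rho>' = \<rho>' \<longrightarrow> \<rho>' = \<rho>)
          \<and> sub_gaussian \<rho>)"
proof -
  interpret coupled_map p c f h
    using assms(1-7) by unfold_locales
  have \<kappa>: "\<kappa> = coupled_map.\<kappa> c f h"
    using assms(8) by (simp add: \<kappa>_def)
  \<comment> \<open>Squaring the hypothesis is legitimate because \<open>\<kappa>\<close> is
    nonnegative, which rests on \<open>c \<le> 1\<close>.\<close>
  have "\<kappa>\<^sup>2 \<le> (sqrt 3 / 2)\<^sup>2"
    using assms(9) \<kappa>_nonneg unfolding \<kappa> by (intro power_mono) auto
  then have \<kappa>_sq: "(coupled_map.\<kappa> c f h)\<^sup>2 \<le> 3/4"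
    unfolding \<kappa> by (simp add: power_divide)
  obtain \<rho> :: "(circle ^ 'n) measure" where \<rho>: "\<rho> \<in> borel_probs" "transfer_op f h p \<rho> = \<rho>"
    and unique: "\<forall>\<rho>'\<in>borel_probs. transfer_op f h p \<rho>' = \<rho>' \<longrightarrow> \<rho>' = \<rho>"
    using transfer_op_fixed_point by blast
  have "sub_gaussian \<rho>" by (rule sub_gaussian_fixed_point[OF \<kappa>_sq \<rho>])
  with \<rho> unique show ?thesis
    unfolding \<open>P = transfer_op f h p\<close> \<kappa>
    using transfer_op_borel_probs sub_gaussian_transfer_op[OF \<kappa>_sq] W1_transfer_op_le by blast
qed

end
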